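(* Let $n,k,D$ be positive integers with $D\le 2k$, let $m(n,2k)=\binom{n+2k}{n}$, and let $\mu$ be a probability measure on $\mathbb{R}^n$ which is absolutely continuous with respect to the Lebesgue measure. For every $\delta>0$ there exists a weak $\left(1-\frac{1}{m(n,2k)+1}+\delta\right)$-net for $(\mu,\mathrm{Poly}_+(n,D))$ with at most $\binom{2k+n}{n}-n-1$ points.
   Context: $\mathrm{Poly}(n,D)$ is the real vector space of polynomials in $n$ variables with real coefficients of degree at most $D$, and $\mathrm{Poly}_+(n,D)=\{\{x\in\mathbb{R}^n : P(x)\ge 0\} : P\in \mathrm{Poly}(n,D)\}$ is the family of superlevel sets of such polynomials. For a family $F$ of subsets of $\mathbb{R}^n$, a probability measure $\mu$ on $\mathbb{R}^n$ and a real number $t$, a set $X\subset\mathbb{R}^n$ is a $t$-net for $(\mu,F)$ if for every $f\in F$ with $\mu(f)>t$ one has $f\cap X\ne\emptyset$. The net is called weak to indicate that $X$ may be any subset of $\mathbb{R}^n$ (it need not lie in the support of $\mu$).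
   Formalization: The case n = k = 1, D = 2 is excluded: there the claimed one-point net {p} does not exist for any δ < 1/4, since the sets {x : (x−p)² ≥ e} miss p and have measure tending to 1 as e → 0 (for δ ≥ 1/4 the claim is vacuous). *)

theory Defs
  imports "HOL-Probability.Probability_Measure" "HOL-Analysis.Analysis"
begin

text \<open>A multi-index is a function \<open>a :: 'n \<Rightarrow> nat\<close>; the finitely many \<open>a\<close> with
  \<open>\<Sum>i. a i \<le> D\<close> index the monomials of total degree at most \<open>D\<close>. Polynomials are
  identified with the functions they induce, which is harmless over the reals.\<close>

definition poly_space :: "nat \<Rightarrow> (real ^ 'n \<Rightarrow> real) set" where
  "poly_space D =
    {P. \<exists>c :: ('n \<Rightarrow> nat) \<Rightarrow> real.
          P = (\<lambda>x. \<Sum>a | (\<Sum>i\<in>UNIV. a i) \<le> D. c a * (\<Prod>i\<in>UNIV. (x $ i) ^ a i))}"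

definition poly_plus :: "nat \<Rightarrow> (real ^ 'n) set set" where
  "poly_plus D = {{x. P x \<ge> 0} | P. P \<in> poly_space D}"

definition weak_net :: "'a measure \<Rightarrow> 'a set set \<Rightarrow> real \<Rightarrow> 'a set \<Rightarrow> bool" where
  "weak_net M F t X \<longleftrightarrow> (\<forall>f\<in>F. measure M f > t \<longrightarrow> f \<inter> X \<noteq> {})"

lemma finite_multi_indices: "finite {a :: 'n::finite \<Rightarrow> nat. (\<Sum>i\<in>UNIV. a i) \<le> D}"
proof (rule finite_subset)
  show "{a :: 'n \<Rightarrow> nat. (\<Sum>i\<in>UNIV. a i) \<le> D} \<subseteq> PiE UNIV (\<lambda>_. {..D})"
  proof
    fix a :: "'n \<Rightarrow> nat" assume "a \<in> {a. (\<Sum>i\<in>UNIV. a i) \<le> D}"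
    hence "a i \<le> D" for i
      using member_le_sum[of i UNIV a] by auto
    thus "a \<in> PiE UNIV (\<lambda>_. {..D})" by auto
  qed
  show "finite (PiE (UNIV :: 'n set) (\<lambda>_. {..D}))" by (intro finite_PiE) auto
qed

text \<open>On the real line, quadratic superlevel sets \<open>{x. (x - p)\<^sup>2 \<ge> e}\<close> avoid the point \<open>p\<close>
  and have measure close to 1. So a single point is never a weak \<open>t\<close>-net for quadratics when
  \<open>t < 1\<close>: with one variable, \<open>k = 1\<close> and \<open>D = 2\<close>, where \<open>(2k+n choose n) - n - 1 = 1\<close>, no net
  of that size exists.\<close>

lemma no_one_point_quadratic_net:
  fixes \<mu> :: "(real ^ 'n) measure" and X :: "(real ^ 'n) set"
  assumes n1: "CARD('n) = 1"
    and "prob_space \<mu>" and sets: "sets \<mu> = sets borel"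
    and ac: "absolutely_continuous lborel \<mu>"
    and t: "t < 1" and X: "finite X" "card X \<le> 1"
  shows "\<not> weak_net \<mu> (poly_plus 2) t X"
proof
  assume net: "weak_net \<mu> (poly_plus 2) t X"
  interpret prob_space \<mu> by fact
  obtain i :: 'n where U: "(UNIV :: 'n set) = {i}"
    using n1 by (auto simp: card_1_singleton_iff)
  obtain p where Xp: "X \<subseteq> {p}"
    using X by (cases "card X = 0") (auto simp: le_Suc_eq card_1_singleton_iff)
  define A where "A k = {x :: real ^ 'n. (x $ i - p $ i)\<^sup>2 - 1 / real (Suc k) \<ge> 0}" for k
  have eqi: "a = b \<longleftrightarrow> a i = b i" for a b :: "'n \<Rightarrow> nat"
    using U by (auto simp: fun_eq_iff)
  have idx: "{a :: 'n \<Rightarrow> nat. (\<Sum>i\<in>UNIV. a i) \<le> 2} = {\<lambda>_. 0, \<lambda>_. 1, \<lambda>_. 2}"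
    by (auto simp: U eqi)
  have mem: "A k \<in> poly_plus 2" for k
  proof -
    define c :: "('n \<Rightarrow> nat) \<Rightarrow> real" where
      "c a = (if a i = 0 then (p $ i)\<^sup>2 - 1 / real (Suc k)
              else if a i = 1 then - 2 * p $ i else 1)" for a
    have "(\<Sum>a | (\<Sum>i\<in>UNIV. a i) \<le> 2. c a * (\<Prod>i\<in>UNIV. (x $ i) ^ a i))
        = (x $ i - p $ i)\<^sup>2 - 1 / real (Suc k)" for x :: "real ^ 'n"
      unfolding idx by (simp add: U eqi c_def power2_eq_square algebra_simps)
    hence "(\<lambda>x. (x $ i - p $ i)\<^sup>2 - 1 / real (Suc k)) \<in> poly_space 2"
      unfolding poly_space_def by (auto intro!: exI[of _ c])
    thus ?thesis unfolding poly_plus_def A_def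
      by (intro CollectI exI[of _ "\<lambda>x. (x $ i - p $ i)\<^sup>2 - 1 / real (Suc k)"]) (rule conjI[OF refl])
  qed
  have inc: "incseq A"
  proof (rule incseq_SucI, rule subsetI)
    fix k x assume "x \<in> A k"
    moreover have "1 / real (Suc (Suc k)) \<le> 1 / real (Suc k)" by (simp add: field_simps)
    ultimately show "x \<in> A (Suc k)" unfolding A_def by auto
  qed
  have un: "(\<Union>k. A k) = - {p}"
  proof (intro equalityI subsetI)
    fix x assume "x \<in> - {p}"
    hence "x $ i \<noteq> p $ i" using U by (auto simp: vec_eq_iff)
    hence "(x $ i - p $ i)\<^sup>2 > 0" by simp
    then obtain k where "inverse (real (Suc k)) < (x $ i - p $ i)\<^sup>2"
      using reals_Archimedean by blast
    thus "x \<in> (\<Union>k. A k)" by (auto simp: A_def inverse_eq_divide intro!: exI[of _ k])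
  qed (auto simp: A_def)
  have cl: "closed (A k)" for k
    unfolding A_def by (intro closed_Collect_le continuous_intros)
  have meas: "range A \<subseteq> sets \<mu>" using cl by (auto simp: sets)
  have "{p} \<in> null_sets lborel" by (auto simp: null_sets_def)
  hence "{p} \<in> null_sets \<mu>" using ac by (auto simp: absolutely_continuous_def)
  hence "prob {p} = 0" by (simp add: measure_eq_0_null_sets)
  moreover have "space \<mu> = UNIV" using sets_eq_imp_space_eq[OF sets] by simp
  ultimately have one: "prob (- {p}) = 1"
    using prob_compl[of "{p}"] by (simp add: sets Compl_eq_Diff_UNIV)
  have "(\<lambda>k. prob (A k)) \<longlonglongrightarrow> 1"
    using finite_Lim_measure_incseq[OF meas inc] un one by simp
  hence "\<forall>\<^sub>F k in sequentially. prob (A k) > t" using t by (rule order_tendstoD(1))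
  then obtain k where "prob (A k) > t" by (auto simp: eventually_sequentially)
  hence "A k \<inter> X \<noteq> {}" using net mem by (auto simp: weak_net_def)
  thus False using Xp by (auto simp: A_def)
qed

end

theory Submission
  imports Defs
begin

text \<open>Homogenising turns polynomials of degree at most \<open>2k\<close> into forms of degree \<open>2k\<close> in \<open>N = n + 1\<close>
  variables; as \<open>2k\<close> is even, signs do not change. Let \<open>G\<close> be the compact set of normalised forms
  whose superlevel set has measure at least \<open>t\<close>. By Caratheodory's theorem every element of the
  convex hull \<open>K\<close> of \<open>G\<close> combines at most \<open>m + 1\<close> elements of \<open>G\<close>, and since \<open>(m + 1)(1 - t) < 1\<close>
  these have a common point of positivity. A minimax argument yields a nonnegative combination \<open>L\<close>
  of point evaluations that is positive on \<open>K\<close>, and so at one of the points of any such combination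
  every form of \<open>G\<close> is positive. It remains to reduce the number of points.

  Fix a point \<open>x\<^sub>0\<close> and let \<open>p\<close> maximise \<open>p x\<^sub>0 / L p\<close> over the nonnegative forms. Every element of
  \<open>K\<close> is then positive at \<open>x\<^sub>0\<close> or at a zero of \<open>p\<close>, so the minimax argument gives a combination that
  uses only these points, and its zeros of \<open>p\<close> can be taken to have independent evaluations. At the
  zeros of \<open>p\<close> all partial derivatives of \<open>p\<close> vanish, and for \<open>k \<ge> 2\<close> this provides \<open>N + 1\<close>
  independent forms of degree \<open>2k\<close> that vanish there; hence at most \<open>m - N - 1\<close> zeros are needed.
  For \<open>k = 1\<close> a positive semidefinite functional on quadratic forms is a sum of \<open>N\<close> evaluations,
  and \<open>N \<le> m - N\<close> when \<open>N \<ge> 3\<close>. For \<open>n = k = D = 1\<close> the barycentre of \<open>L\<close> suffices. Finally, points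
  at infinity are moved to finite ones, which is harmless because \<open>G\<close> is compact.\<close>

section \<open>Forms\<close>

definition exps :: "nat \<Rightarrow> ('v::finite \<Rightarrow> nat) set" where
  "exps d = {b. (\<Sum>i\<in>UNIV. b i) = d}"

definition mon :: "('v::finite \<Rightarrow> nat) \<Rightarrow> real ^ 'v \<Rightarrow> real" where
  "mon b y = (\<Prod>i\<in>UNIV. (y $ i) ^ b i)"

text \<open>Forms are handled through coefficient functions because these carry the product
  topology, in which compactness is argued later; values outside \<open>exps d\<close> are
  ignored.\<close>

definition evalf :: "nat \<Rightarrow> (('v::finite \<Rightarrow> nat) \<Rightarrow> real) \<Rightarrow> real ^ 'v \<Rightarrow> real" where
  "evalf d c y = (\<Sum>b\<in>exps d. c b * mon b y)"

definition forms :: "nat \<Rightarrow> (real ^ 'v::finite \<Rightarrow> real) set" where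
  "forms d = range (evalf d)"

lemma finite_exps [simp]: "finite (exps d :: ('v::finite \<Rightarrow> nat) set)"
  by (rule finite_subset[OF _ finite_multi_indices[of d]]) (auto simp: exps_def)

lemma evalf_in_forms [simp]: "evalf d c \<in> forms d"
  by (simp add: forms_def)

lemma formsE:
  assumes "F \<in> forms d"
  obtains c where "F = evalf d c"
  using assms by (auto simp: forms_def)

lemma forms_zero [simp]: "(\<lambda>_. 0) \<in> forms d"
proof -
  have "(\<lambda>_. 0) = evalf d (\<lambda>_. 0)" by (auto simp: evalf_def)
  thus ?thesis by (metis evalf_in_forms)
qed

lemma forms_add [intro]:
  assumes "F \<in> forms d" "G \<in> forms d"
  shows "(\<lambda>y. F y + G y) \<in> forms d"
proof -
  obtain c e where "F = evalf d c" "G = evalf d e" using assms by (auto elim!: formsE)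
  hence "(\<lambda>y. F y + G y) = evalf d (\<lambda>b. c b + e b)"
    by (auto simp: evalf_def sum.distrib algebra_simps)
  thus ?thesis by simp
qed

lemma forms_scale [intro]:
  assumes "F \<in> forms d"
  shows "(\<lambda>y. s * F y) \<in> forms d"
proof -
  obtain c where "F = evalf d c" using assms by (auto elim!: formsE)
  hence "(\<lambda>y. s * F y) = evalf d (\<lambda>b. s * c b)"
    by (auto simp: evalf_def sum_distrib_left algebra_simps)
  thus ?thesis by simp
qed

lemma forms_sum [intro]:
  assumes "\<And>i. i \<in> S \<Longrightarrow> F i \<in> forms d"
  shows "(\<lambda>y. \<Sum>i\<in>S. F i y) \<in> forms d"
proof (cases "finite S")
  case True
  thus ?thesis using assms by (induction S) auto
qed auto

lemma forms_diff [intro]: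
  assumes "F \<in> forms d" "G \<in> forms d"
  shows "(\<lambda>y. F y - G y) \<in> forms d"
  using forms_add[OF assms(1) forms_scale[OF assms(2), of "-1"]] by simp

lemma mon_in_forms:
  assumes "b \<in> exps d"
  shows "mon b \<in> forms d"
proof -
  have "mon b = evalf d (\<lambda>b'. if b' = b then 1 else 0)"
    using assms by (auto simp: evalf_def of_bool_def if_distrib[of "\<lambda>x. x * _"] cong: if_cong)
  thus ?thesis by simp
qed

lemma mon_Suc: "mon (b(i := Suc (b i))) y = y $ i * mon b y"
proof -
  have "mon b' y = (y $ i) ^ b' i * (\<Prod>j\<in>UNIV - {i}. (y $ j) ^ b' j)" for b'
    unfolding mon_def by (rule prod.remove) auto
  from this[of b] this[of "b(i := Suc (b i))"] show ?thesis by simp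
qed

lemma exps_Suc:
  assumes "b \<in> exps d"
  shows "b(i := Suc (b i)) \<in> exps (Suc d)"
proof -
  have "(\<Sum>j\<in>UNIV. b' j) = b' i + (\<Sum>j\<in>UNIV - {i}. b' j)" for b' :: "'a \<Rightarrow> nat"
    by (rule sum.remove) auto
  from this[of b] this[of "b(i := Suc (b i))"] assms show ?thesis by (simp add: exps_def)
qed

lemma exps_SucE:
  assumes "b \<in> exps (Suc d)"
  obtains i b' where "b = b'(i := Suc (b' i))" "b' \<in> exps d"
proof -
  have "\<exists>i. b i \<noteq> 0"
    by (rule ccontr) (use assms in \<open>simp add: exps_def\<close>)
  then obtain i where i: "b i \<noteq> 0" by auto
  have *: "(\<Sum>j\<in>UNIV. b' j) = b' i + (\<Sum>j\<in>UNIV - {i}. b' j)" for b' :: "'a \<Rightarrow> nat"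
    by (rule sum.remove) auto
  let ?b = "b(i := b i - 1)"
  have "?b \<in> exps d" using *[of b] *[of ?b] assms i by (simp add: exps_def)
  moreover have "b = ?b(i := Suc (?b i))" using i by auto
  ultimately show thesis using that by blast
qed

lemma forms_coord [intro]:
  assumes "F \<in> forms d"
  shows "(\<lambda>y. y $ i * F y) \<in> forms (Suc d)"
proof -
  obtain c where F: "F = evalf d c" using assms by (auto elim!: formsE)
  have "(\<lambda>y. \<Sum>b\<in>exps d. c b * mon (b(i := Suc (b i))) y) \<in> forms (Suc d)"
    by (intro forms_sum forms_scale mon_in_forms exps_Suc)
  moreover have "(\<lambda>y. \<Sum>b\<in>exps d. c b * mon (b(i := Suc (b i))) y) = (\<lambda>y. y $ i * F y)"
    unfolding F evalf_def mon_Suc sum_distrib_left by (simp add: mult_ac)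
  ultimately show ?thesis by simp
qed

lemma forms_0E:
  assumes "F \<in> forms 0"
  obtains c where "F = (\<lambda>_. c)"
proof -
  have "exps 0 = {\<lambda>_::'a. 0 :: nat}" by (auto simp: exps_def fun_eq_iff)
  thus thesis using assms that by (auto elim!: formsE simp: evalf_def mon_def fun_eq_iff)
qed

lemma const_in_forms [simp]: "(\<lambda>_. c) \<in> forms 0"
proof -
  have "exps 0 = {\<lambda>_::'a. 0 :: nat}" by (auto simp: exps_def fun_eq_iff)
  hence "(\<lambda>_. c) = evalf 0 (\<lambda>_::'a \<Rightarrow> nat. c)" by (auto simp: evalf_def mon_def)
  thus ?thesis by simp
qed

text \<open>A monomial of positive degree has a coordinate factor, so sums of forms
  \<open>y $ i * G y\<close> exhaust the forms of degree \<open>Suc d\<close>. The induction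
  replaces computations with exponents.\<close>

lemma forms_Suc_induct [consumes 1, case_names zero add coord]:
  assumes F: "F \<in> forms (Suc d)"
    and z: "P (\<lambda>_. 0)"
    and a: "\<And>F G. P F \<Longrightarrow> P G \<Longrightarrow> P (\<lambda>y. F y + G y)"
    and c: "\<And>i G. G \<in> forms d \<Longrightarrow> P (\<lambda>y. y $ i * G y)"
  shows "P F"
proof -
  obtain w where w: "F = evalf (Suc d) w" using F by (auto elim!: formsE)
  have "P (\<lambda>y. \<Sum>b\<in>S. w b * mon b y)" if "finite S" "S \<subseteq> exps (Suc d)" for S
    using that
  proof (induction S)
    case (insert b S)
    obtain i b' where b: "b = b'(i := Suc (b' i))" "b' \<in> exps d"
      using insert.prems by (auto elim: exps_SucE)
    have "P (\<lambda>y. y $ i * (w b * mon b' y))"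
      by (intro c forms_scale mon_in_forms b(2))
    hence "P (\<lambda>y. w b * mon b y)" unfolding b(1) mon_Suc by (simp add: mult_ac)
    with insert show ?case by (simp add: a)
  qed (simp add: z)
  from this[of "exps (Suc d)"] show ?thesis by (simp add: w evalf_def[abs_def])
qed

lemma forms_Suc_decomp:
  assumes "F \<in> forms (Suc d)"
  shows "\<exists>G. (\<forall>i. G i \<in> forms d) \<and> (\<forall>y. F y = (\<Sum>i\<in>UNIV. y $ i * G i y))"
  using assms
proof (induction rule: forms_Suc_induct)
  case zero
  show ?case by (rule exI[of _ "\<lambda>_ _. 0"]) auto
next
  case (add F1 F2)
  then obtain G1 G2 where "\<forall>i. G1 i \<in> forms d" "\<forall>y. F1 y = (\<Sum>i\<in>UNIV. y $ i * G1 i y)"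
    "\<forall>i. G2 i \<in> forms d" "\<forall>y. F2 y = (\<Sum>i\<in>UNIV. y $ i * G2 i y)" by blast
  thus ?case
    by (intro exI[of _ "\<lambda>i y. G1 i y + G2 i y"]) (auto simp: sum.distrib algebra_simps)
next
  case (coord i G)
  show ?case
  proof (rule exI[of _ "\<lambda>j. if j = i then G else (\<lambda>_. 0)"], intro conjI allI)
    show "y $ i * G y = (\<Sum>j\<in>UNIV. y $ j * (if j = i then G else (\<lambda>_. 0)) y)" for y
      by (simp add: if_distrib[of "\<lambda>f. f _"] if_distrib[of "\<lambda>x. _ * x"] cong: if_cong)
  qed (simp add: coord)
qed

text \<open>The partial derivatives \<open>G i\<close> are obtained together with the fact that they
  are forms of one degree less; the essential step is the product rule for
  \<open>y $ i * H y\<close>.\<close>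

lemma forms_has_derivative:
  assumes "F \<in> forms (Suc d)"
  shows "\<exists>G. (\<forall>i. G i \<in> forms d) \<and>
    (\<forall>y. (F has_derivative (\<lambda>h. \<Sum>i\<in>UNIV. h $ i * G i y)) (at y))"
  using assms
proof (induction d arbitrary: F)
  case (0 F)
  obtain G where G: "\<forall>i. G i \<in> forms 0" "\<forall>y. F y = (\<Sum>i\<in>UNIV. y $ i * G i y)"
    using forms_Suc_decomp[OF 0] by blast
  have "\<forall>i. \<exists>c. G i = (\<lambda>_. c)" using G(1) by (auto elim: forms_0E)
  then obtain c where c: "\<And>i. G i = (\<lambda>_. c i)" by metis
  have F: "F = (\<lambda>y. \<Sum>i\<in>UNIV. y $ i * c i)" using G(2) by (simp add: c fun_eq_iff)
  have "(F has_derivative (\<lambda>h. \<Sum>i\<in>UNIV. h $ i * G i y)) (at y)" for y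
    unfolding F c by (auto intro!: derivative_eq_intros bounded_linear.has_derivative[OF bounded_linear_vec_nth])
  with G(1) show ?case by blast
next
  case (Suc d F)
  show ?case using Suc.prems
  proof (induction rule: forms_Suc_induct)
    case zero
    show ?case by (rule exI[of _ "\<lambda>_ _. 0"]) auto
  next
    case (add F1 F2)
    then obtain G1 G2 where "\<forall>i. G1 i \<in> forms (Suc d)"
      "\<forall>y. (F1 has_derivative (\<lambda>h. \<Sum>i\<in>UNIV. h $ i * G1 i y)) (at y)"
      "\<forall>i. G2 i \<in> forms (Suc d)"
      "\<forall>y. (F2 has_derivative (\<lambda>h. \<Sum>i\<in>UNIV. h $ i * G2 i y)) (at y)" by blast
    thus ?case
      by (intro exI[of _ "\<lambda>i y. G1 i y + G2 i y"])
        (auto simp: sum.distrib algebra_simps intro!: has_derivative_add)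
  next
    case (coord i H)
    obtain G where G: "\<forall>i. G i \<in> forms d"
      "\<forall>y. (H has_derivative (\<lambda>h. \<Sum>i\<in>UNIV. h $ i * G i y)) (at y)"
      using Suc.IH[OF coord] by blast
    show ?case
    proof (intro exI[of _ "\<lambda>j y. (if j = i then 1 else 0) * H y + y $ i * G j y"] conjI allI)
      fix y
      have "((\<lambda>y. y $ i * H y) has_derivative
        (\<lambda>h. y $ i * (\<Sum>j\<in>UNIV. h $ j * G j y) + h $ i * H y)) (at y)"
        using G(2) by (intro has_derivative_mult
          bounded_linear.has_derivative[OF bounded_linear_vec_nth has_derivative_ident]) auto
      also have "(\<lambda>h. y $ i * (\<Sum>j\<in>UNIV. h $ j * G j y) + h $ i * H y) =
        (\<lambda>h. \<Sum>j\<in>UNIV. h $ j * ((if j = i then 1 else 0) * H y + y $ i * G j y))"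
        by (auto simp: fun_eq_iff algebra_simps sum.distrib sum_distrib_left if_distrib[of "\<lambda>x. _ * x"] cong: if_cong)
      finally show "((\<lambda>y. y $ i * H y) has_derivative
        (\<lambda>h. \<Sum>j\<in>UNIV. h $ j * ((if j = i then 1 else 0) * H y + y $ i * G j y))) (at y)" .
    qed (intro forms_add forms_scale forms_coord coord G(1)[rule_format])
  qed
qed

section \<open>Homogeneity, continuity and zeros on lines\<close>

lemma mon_scaleR:
  assumes "b \<in> exps d"
  shows "mon b (s *\<^sub>R y) = s ^ d * mon b y"
  using assms by (simp add: mon_def power_mult_distrib prod.distrib power_sum[symmetric] exps_def)

lemma evalf_scaleR: "evalf d c (s *\<^sub>R y) = s ^ d * evalf d c y"
  by (auto simp: evalf_def mon_scaleR sum_distrib_left intro!: sum.cong)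

lemma forms_scaleR:
  assumes "F \<in> forms d"
  shows "F (s *\<^sub>R y) = s ^ d * F y"
  using assms by (auto elim!: formsE simp: evalf_scaleR)

lemma continuous_on_mon [continuous_intros]:
  "continuous_on S f \<Longrightarrow> continuous_on S (\<lambda>x. mon b (f x))"
  unfolding mon_def by (intro continuous_intros)

lemma forms_continuous:
  assumes "F \<in> forms d"
  shows "continuous_on S F"
proof -
  obtain c where F: "F = evalf d c" using assms by (auto elim!: formsE)
  show ?thesis unfolding F evalf_def[abs_def] by (intro continuous_intros)
qed

lemma forms_line:
  assumes "F \<in> forms d"
  shows "\<exists>p :: real poly. \<forall>t. F (u + t *\<^sub>R v) = poly p t"
proof -
  obtain c where F: "F = evalf d c" using assms by (auto elim!: formsE)
  show ?thesis
    by (rule exI[of _ "\<Sum>b\<in>exps d. smult (c b) (\<Prod>i\<in>UNIV. [:u $ i, v $ i:] ^ b i)"])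
      (simp add: F evalf_def mon_def poly_sum poly_prod)
qed

lemma finite_zeros_forms_line:
  assumes "F \<in> forms d" "F (u + t0 *\<^sub>R v) \<noteq> 0"
  shows "finite {t. F (u + t *\<^sub>R v) = 0}"
proof -
  obtain p where p: "\<And>t. F (u + t *\<^sub>R v) = poly p t" using forms_line[OF assms(1)] by blast
  have "p \<noteq> 0" using p[of t0] assms(2) by auto
  thus ?thesis unfolding p by (rule poly_roots_finite)
qed

text \<open>On the line through a point where \<open>F\<close> is nonzero and a point where
  \<open>G\<close> is nonzero, each of them has only finitely many zeros, and two finite sets do not
  cover a line.\<close>

lemma forms_no_zero_divisors:
  assumes "F \<in> forms d" "G \<in> forms e" and z: "\<And>y. F y * G y = 0"
  shows "(\<forall>y. F y = 0) \<or> (\<forall>y. G y = 0)"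
proof (rule ccontr)
  assume "\<not> ?thesis"
  then obtain u v where uv: "F u \<noteq> 0" "G v \<noteq> 0" by blast
  have "finite {t. F (u + t *\<^sub>R (v - u)) = 0}"
    using uv by (intro finite_zeros_forms_line[OF assms(1), of _ 0]) simp
  moreover have "finite {t. G (u + t *\<^sub>R (v - u)) = 0}"
    using uv by (intro finite_zeros_forms_line[OF assms(2), of _ 1]) simp
  moreover have "UNIV = {t. F (u + t *\<^sub>R (v - u)) = 0} \<union> {t. G (u + t *\<^sub>R (v - u)) = 0}"
    using z by auto
  ultimately have "finite (UNIV :: real set)" by (metis finite_Un)
  thus False by (simp add: infinite_UNIV_char_0)
qed

text \<open>Induction on the variables: grouping the exponents by the power of the new variable
  \<open>j\<close> gives a polynomial in one variable that vanishes identically, so each group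
  vanishes on its own.\<close>

lemma monomials_independent:
  fixes c :: "('v::finite \<Rightarrow> nat) \<Rightarrow> real"
  assumes "finite S" "finite A"
    and "\<And>a b. a \<in> A \<Longrightarrow> b \<in> A \<Longrightarrow> (\<forall>i\<in>S. a i = b i) \<Longrightarrow> a = b"
    and "\<And>x. (\<Sum>a\<in>A. c a * (\<Prod>i\<in>S. x i ^ a i)) = 0"
    and "a0 \<in> A"
  shows "c a0 = 0"
  using assms
proof (induction S arbitrary: A rule: finite_induct)
  case empty
  hence "A = {a0}" by auto
  thus ?case using empty.prems(3)[of "\<lambda>_. 0"] by simp
next
  case (insert j S A)
  define M where "M = Max ((\<lambda>a. a j) ` A)"
  have M: "a j \<le> M" if "a \<in> A" for a
    unfolding M_def using that insert.prems(1) by simp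
  define B where "B d = {a \<in> A. a j = d}" for d
  have B0: "(\<Sum>a\<in>B d. c a * (\<Prod>i\<in>S. x i ^ a i)) = 0" if d: "d \<le> M" for d x
  proof -
    have "(\<Sum>d\<le>M. (\<Sum>a\<in>B d. c a * (\<Prod>i\<in>S. x i ^ a i)) * t ^ d) = 0" for t
    proof -
      have "(\<Sum>d\<le>M. (\<Sum>a\<in>B d. c a * (\<Prod>i\<in>S. x i ^ a i)) * t ^ d)
        = (\<Sum>d\<le>M. \<Sum>a\<in>B d. c a * (t ^ a j * (\<Prod>i\<in>S. x i ^ a i)))"
        by (intro sum.cong refl) (auto simp: sum_distrib_left sum_distrib_right B_def mult_ac intro!: sum.cong)
      also have "\<dots> = (\<Sum>a\<in>A. c a * (t ^ a j * (\<Prod>i\<in>S. x i ^ a i)))"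
        unfolding B_def by (rule sum.group) (use insert.prems(1) M in auto)
      also have "\<dots> = (\<Sum>a\<in>A. c a * (\<Prod>i\<in>insert j S. (x(j := t)) i ^ a i))"
      proof -
        have "(\<Prod>i\<in>S. (x(j := t)) i ^ a i) = (\<Prod>i\<in>S. x i ^ a i)" for a
          by (rule prod.cong) (use insert.hyps in auto)
        thus ?thesis using insert.hyps by simp
      qed
      also have "\<dots> = 0" by (rule insert.prems(3))
      finally show ?thesis .
    qed
    hence "\<forall>t. (\<Sum>d\<le>M. (\<Sum>a\<in>B d. c a * (\<Prod>i\<in>S. x i ^ a i)) * t ^ d) = 0" by blast
    thus ?thesis using d unfolding polyfun_eq_0 by blast
  qed
  show ?case
  proof (rule insert.IH[of "B (a0 j)"])
    show "finite (B (a0 j))" unfolding B_def using insert.prems(1) by simp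
    show "a = b" if "a \<in> B (a0 j)" "b \<in> B (a0 j)" "\<forall>i\<in>S. a i = b i" for a b
      using that insert.prems(2)[of a b] by (auto simp: B_def)
  qed (use B0 M insert.prems(4) in \<open>auto simp: B_def\<close>)
qed

lemma evalf_eq_0D:
  assumes "\<And>y. evalf d c y = 0" "b \<in> exps d"
  shows "c b = 0"
proof (rule monomials_independent[of UNIV "exps d" c])
  fix x :: "'a \<Rightarrow> real"
  show "(\<Sum>a\<in>exps d. c a * (\<Prod>i\<in>UNIV. x i ^ a i)) = 0"
    using assms(1)[of "\<chi> i. x i"] by (simp add: evalf_def mon_def)
qed (use assms(2) in auto)

section \<open>Independence and minimax\<close>

text \<open>The vectors are indexed by \<open>F\<close>, so a repeated vector counts as dependent;
  only the coordinates in \<open>I\<close> are compared.\<close>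

definition indep_vecs :: "'i set \<Rightarrow> ('f \<Rightarrow> 'i \<Rightarrow> real) \<Rightarrow> 'f set \<Rightarrow> bool" where
  "indep_vecs I u F \<longleftrightarrow> (\<forall>\<alpha>. (\<forall>i\<in>I. (\<Sum>f\<in>F. \<alpha> f * u f i) = 0) \<longrightarrow> (\<forall>f\<in>F. \<alpha> f = 0))"

text \<open>Gaussian elimination: a vector \<open>g\<close> with nonzero coordinate \<open>j\<close>
  serves as pivot and clears that coordinate from the others.\<close>

lemma not_indep_vecs_if_card:
  fixes u :: "'f \<Rightarrow> 'i \<Rightarrow> real"
  assumes "finite I" "finite F" "card I < card F"
  shows "\<not> indep_vecs I u F"
proof -
  have "\<exists>\<alpha>. (\<exists>f\<in>F. \<alpha> f \<noteq> 0) \<and> (\<forall>i\<in>I. (\<Sum>f\<in>F. \<alpha> f * u f i) = 0)"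
    using assms
  proof (induction I arbitrary: F u rule: finite_induct)
    case empty
    hence "F \<noteq> {}" by auto
    thus ?case by (intro exI[of _ "\<lambda>_. 1"]) auto
  next
    case (insert j I F u)
    have cF: "card I < card F" using insert by auto
    show ?case
    proof (cases "\<forall>f\<in>F. u f j = 0")
      case True
      obtain \<alpha> where "\<exists>f\<in>F. \<alpha> f \<noteq> 0" "\<forall>i\<in>I. (\<Sum>f\<in>F. \<alpha> f * u f i) = 0"
        using insert.IH[OF insert.prems(1) cF, of u] by blast
      with True show ?thesis by (intro exI[of _ \<alpha>]) auto
    next
      case False
      then obtain g where g: "g \<in> F" "u g j \<noteq> 0" by auto
      define F' where "F' = F - {g}"
      have F': "finite F'" "g \<notin> F'" "F = insert g F'"
        using insert.prems g by (auto simp: F'_def)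
      have "card I < card F'" using insert.prems insert.hyps F' by simp
      from insert.IH[OF F'(1) this, of "\<lambda>f i. u f i - u f j / u g j * u g i"]
      obtain \<alpha> where \<alpha>: "\<exists>f\<in>F'. \<alpha> f \<noteq> 0"
        "\<And>i. i \<in> I \<Longrightarrow> (\<Sum>f\<in>F'. \<alpha> f * (u f i - u f j / u g j * u g i)) = 0" by blast
      \<comment> \<open>The coefficient of the pivot is chosen so that coordinate \<open>j\<close>
        cancels.\<close>
      define \<beta> where "\<beta> = \<alpha>(g := - (\<Sum>f\<in>F'. \<alpha> f * u f j) / u g j)"
      have \<beta>: "(\<Sum>f\<in>F. \<beta> f * u f i)
          = (\<Sum>f\<in>F'. \<alpha> f * u f i) - (\<Sum>f\<in>F'. \<alpha> f * u f j) / u g j * u g i" for i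
      proof -
        have "(\<Sum>f\<in>F'. \<beta> f * u f i) = (\<Sum>f\<in>F'. \<alpha> f * u f i)"
          using F'(2) by (intro sum.cong) (auto simp: \<beta>_def)
        thus ?thesis using F' by (simp add: \<beta>_def)
      qed
      have "(\<Sum>f\<in>F. \<beta> f * u f i) = 0" if "i \<in> insert j I" for i
      proof (cases "i = j")
        case True thus ?thesis using g by (simp add: \<beta>)
      next
        case False
        hence "(\<Sum>f\<in>F'. \<alpha> f * (u f i - u f j / u g j * u g i)) = 0" using that \<alpha>(2) by auto
        thus ?thesis unfolding \<beta>
          by (simp add: algebra_simps sum_subtractf sum_distrib_left sum_divide_distrib)
      qed
      moreover have "\<exists>f\<in>F. \<beta> f \<noteq> 0" using \<alpha>(1) F' by (auto simp: \<beta>_def)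
      ultimately show ?thesis by blast
    qed
  qed
  thus ?thesis unfolding indep_vecs_def by blast
qed

text \<open>While the family is dependent, the weights can be moved along a dependence until one of
  them becomes zero, and that vector is dropped.\<close>

lemma conic_caratheodory:
  fixes u :: "'f \<Rightarrow> 'i \<Rightarrow> real"
  assumes "finite F" "\<And>f. f \<in> F \<Longrightarrow> w f \<ge> 0"
  shows "\<exists>F' w'. F' \<subseteq> F \<and> (\<forall>f\<in>F'. w' f \<ge> 0) \<and>
    (\<forall>i\<in>I. (\<Sum>f\<in>F'. w' f * u f i) = (\<Sum>f\<in>F. w f * u f i)) \<and> indep_vecs I u F'"
  using assms
proof (induction F arbitrary: w rule: finite_psubset_induct)
  case (psubset F w)
  have drop: ?case if g: "g \<in> F" "v g = 0" and v: "\<And>f. f \<in> F \<Longrightarrow> v f \<ge> 0"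
    and eq: "\<And>i. i \<in> I \<Longrightarrow> (\<Sum>f\<in>F. v f * u f i) = (\<Sum>f\<in>F. w f * u f i)" for g and v :: "'f \<Rightarrow> real"
  proof -
    have "(\<Sum>f\<in>F. v f * u f i) = (\<Sum>f\<in>F - {g}. v f * u f i)" for i
      using g psubset.hyps by (simp add: sum.remove[of F g])
    moreover obtain F' w' where "F' \<subseteq> F - {g}" "\<forall>f\<in>F'. w' f \<ge> 0"
      "\<forall>i\<in>I. (\<Sum>f\<in>F'. w' f * u f i) = (\<Sum>f\<in>F - {g}. v f * u f i)" "indep_vecs I u F'"
    proof -
      have "F - {g} \<subset> F" using g by blast
      from psubset.IH[OF this, of v] v that show thesis by blast
    qed
    ultimately show ?thesis using eq by (intro exI[of _ F'] exI[of _ w']) auto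
  qed
  show ?case
  proof (cases "indep_vecs I u F")
    case True
    thus ?thesis using psubset.prems by blast
  next
    case False
    then obtain \<beta> g where \<beta>: "\<forall>i\<in>I. (\<Sum>f\<in>F. \<beta> f * u f i) = 0" "g \<in> F" "\<beta> g \<noteq> 0"
      by (auto simp: indep_vecs_def)
    \<comment> \<open>The sign factor makes the coefficient at \<open>g\<close> positive, so that
      some weight is bound to decrease.\<close>
    define \<alpha> where "\<alpha> f = \<beta> f * sgn (\<beta> g)" for f
    have "(\<Sum>f\<in>F. \<alpha> f * u f i) = sgn (\<beta> g) * (\<Sum>f\<in>F. \<beta> f * u f i)" for i
      by (simp add: \<alpha>_def sum_distrib_left mult_ac)
    hence \<alpha>: "\<And>i. i \<in> I \<Longrightarrow> (\<Sum>f\<in>F. \<alpha> f * u f i) = 0" "\<alpha> g > 0"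
      using \<beta> by (auto simp: \<alpha>_def sgn_if)
    define P where "P = {f \<in> F. \<alpha> f > 0}"
    have P: "finite P" "g \<in> P" using psubset.hyps \<beta>(2) \<alpha>(2) by (auto simp: P_def)
    define h where "h = arg_min_on (\<lambda>f. w f / \<alpha> f) P"
    have h: "h \<in> P" "\<And>f. f \<in> P \<Longrightarrow> w h / \<alpha> h \<le> w f / \<alpha> f"
      using arg_min_if_finite(1)[OF P(1), of "\<lambda>f. w f / \<alpha> f"]
        arg_min_least[OF P(1), of _ "\<lambda>f. w f / \<alpha> f"] P by (auto simp: h_def)
    have h': "h \<in> F" "\<alpha> h > 0" using h(1) by (auto simp: P_def)
    \<comment> \<open>The largest step that keeps all weights nonnegative; the weight of
      \<open>h\<close> becomes zero.\<close>
    define \<theta> where "\<theta> = w h / \<alpha> h"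
    have \<theta>: "\<theta> \<ge> 0" using h' psubset.prems by (simp add: \<theta>_def)
    show ?thesis
    proof (rule drop[of h "\<lambda>f. w f - \<theta> * \<alpha> f"])
      show "h \<in> F" by fact
      show "w h - \<theta> * \<alpha> h = 0" using h' by (simp add: \<theta>_def)
      show "w f - \<theta> * \<alpha> f \<ge> 0" if "f \<in> F" for f
      proof (cases "\<alpha> f > 0")
        case True
        hence "\<theta> \<le> w f / \<alpha> f" using that h(2)[of f] by (simp add: P_def \<theta>_def)
        thus ?thesis using True by (simp add: field_simps)
      next
        case False
        hence "\<theta> * \<alpha> f \<le> 0" using \<theta> by (simp add: mult_nonneg_nonpos)
        thus ?thesis using psubset.prems[OF that] by linarith
      qed
      show "(\<Sum>f\<in>F. (w f - \<theta> * \<alpha> f) * u f i) = (\<Sum>f\<in>F. w f * u f i)" if "i \<in> I" for i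
      proof -
        have "(\<Sum>f\<in>F. (w f - \<theta> * \<alpha> f) * u f i)
            = (\<Sum>f\<in>F. w f * u f i) - \<theta> * (\<Sum>f\<in>F. \<alpha> f * u f i)"
          by (simp add: algebra_simps sum_subtractf sum_distrib_left)
        thus ?thesis using \<alpha>(1)[OF that] by simp
      qed
    qed
  qed
qed

text \<open>Compactness leaves finitely many points \<open>F\<close>, and the weights are the
  positive parts of the values at that \<open>c0\<close> in \<open>K\<close> which minimises the sum
  of the squared positive parts. By convexity, an element with nonpositive weighted sum would give a
  direction of descent.\<close>

lemma minimax_cover:
  fixes E :: "'c::topological_space \<Rightarrow> 'y \<Rightarrow> real"
  assumes K: "compact K"
    and cont: "\<And>y. y \<in> T \<Longrightarrow> continuous_on K (\<lambda>c. E c y)"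
    and conv: "\<And>c c' t. \<lbrakk>c \<in> K; c' \<in> K; 0 \<le> t; t \<le> 1\<rbrakk> \<Longrightarrow>
      \<exists>c''\<in>K. \<forall>y\<in>T. E c'' y = E c y + t * (E c' y - E c y)"
    and pos: "\<And>c. c \<in> K \<Longrightarrow> \<exists>y\<in>T. E c y > 0"
  shows "\<exists>F w. finite F \<and> F \<subseteq> T \<and> (\<forall>y\<in>F. w y \<ge> 0) \<and> (\<forall>c\<in>K. (\<Sum>y\<in>F. w y * E c y) > 0)"
proof (cases "K = {}")
  case True
  thus ?thesis by auto
next
  case False
  have "\<exists>U. open U \<and> U \<inter> K = (\<lambda>c. E c y) -` {0<..} \<inter> K" if "y \<in> T" for y
    using cont[OF that] open_greaterThan[of "0::real"] unfolding continuous_on_open_invariant by blast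
  then obtain U where U: "\<And>y. y \<in> T \<Longrightarrow> open (U y)"
      "\<And>y. y \<in> T \<Longrightarrow> U y \<inter> K = (\<lambda>c. E c y) -` {0<..} \<inter> K" by metis
  have "K \<subseteq> (\<Union>y\<in>T. U y)" using pos U(2) by fastforce
  then obtain F where F: "F \<subseteq> T" "finite F" "K \<subseteq> (\<Union>y\<in>F. U y)"
    using compactE_image[OF K, of T U] U(1) by blast
  have posF: "\<exists>y\<in>F. E c y > 0" if c: "c \<in> K" for c
  proof -
    obtain y where "y \<in> F" "c \<in> U y" using F c by auto
    thus ?thesis using U(2)[of y] F c by auto
  qed
  define f where "f c = (\<Sum>y\<in>F. (max 0 (E c y))\<^sup>2)" for c
  have "continuous_on K f"
    unfolding f_def using F by (intro continuous_intros cont) auto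
  then obtain c0 where c0: "c0 \<in> K" "\<And>c. c \<in> K \<Longrightarrow> f c0 \<le> f c"
    using continuous_attains_inf[OF K False] by blast
  define w where "w y = max 0 (E c0 y)" for y
  have fpos: "f c0 > 0"
  proof -
    obtain y where y: "y \<in> F" "E c0 y > 0" using posF c0 by blast
    have "0 < (max 0 (E c0 y))\<^sup>2" using y by simp
    also have "\<dots> \<le> f c0" unfolding f_def using F y by (intro member_le_sum) auto
    finally show ?thesis .
  qed
  have "(\<Sum>y\<in>F. w y * E c y) > 0" if c: "c \<in> K" for c
  proof (rule ccontr)
    assume neg: "\<not> ?thesis"
    define \<Delta> where "\<Delta> y = E c y - E c0 y" for y
    define s where "s = (\<Sum>y\<in>F. w y * \<Delta> y)"
    define q where "q = (\<Sum>y\<in>F. (\<Delta> y)\<^sup>2)"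
    have q: "q \<ge> 0" unfolding q_def by (intro sum_nonneg) auto
    have ww: "w y * E c0 y = (w y)\<^sup>2" for y
      by (simp add: w_def max_def power2_eq_square)
    have "s = (\<Sum>y\<in>F. w y * E c y) - f c0"
      by (simp add: s_def \<Delta>_def right_diff_distrib sum_subtractf ww f_def w_def[symmetric])
    hence s: "s < 0" using neg fpos by linarith
    \<comment> \<open>Small enough for the negative linear term \<open>2 * t * s\<close> to outweigh
      \<open>t * t * q\<close>.\<close>
    define t where "t = min 1 (- s / (q + 1))"
    have t: "0 < t" "t \<le> 1" using s q by (auto simp: t_def divide_neg_pos)
    obtain c'' where c'': "c'' \<in> K" "\<forall>y\<in>T. E c'' y = E c0 y + t * (E c y - E c0 y)"
      using conv[OF c0(1) c, of t] t by auto
    \<comment> \<open>Adding the increment after taking the positive part can only enlarge the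
      square; this gives a bound that is quadratic in \<open>t\<close>.\<close>
    have sq: "(max 0 (a + h))\<^sup>2 \<le> (max 0 a + h)\<^sup>2" for a h :: real
    proof (cases "a + h > 0")
      case True
      thus ?thesis by (intro power_mono) auto
    qed auto
    have "f c0 \<le> f c''" using c0 c'' by blast
    also have "f c'' \<le> (\<Sum>y\<in>F. (w y + t * \<Delta> y)\<^sup>2)"
      unfolding f_def w_def \<Delta>_def using c'' F by (intro sum_mono) (auto intro!: sq)
    also have "\<dots> = f c0 + 2 * t * s + t * t * q"
    proof -
      have "(w y + t * \<Delta> y)\<^sup>2 = (w y)\<^sup>2 + 2 * t * (w y * \<Delta> y) + t * t * (\<Delta> y)\<^sup>2" for y
        by (simp add: power2_eq_square algebra_simps)
      thus ?thesis by (simp add: sum.distrib f_def w_def[symmetric] s_def q_def sum_distrib_left)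
    qed
    finally have "0 \<le> t * (2 * s + t * q)" by (simp add: algebra_simps)
    hence "0 \<le> 2 * s + t * q" using t(1) by (simp add: zero_le_mult_iff)
    moreover have "t * q \<le> - s"
    proof -
      have "t * q \<le> - s / (q + 1) * q" unfolding t_def using q by (intro mult_right_mono) auto
      also have "\<dots> \<le> - s" using q s by (simp add: field_simps)
      finally show ?thesis .
    qed
    ultimately show False using s by linarith
  qed
  thus ?thesis using F by (intro exI[of _ F] exI[of _ w]) (auto simp: w_def)
qed


section \<open>Quadratic forms\<close>

lemma forms_1_linear:
  assumes "F \<in> forms (Suc 0)"
  shows "\<exists>c. \<forall>y. F y = (\<Sum>j\<in>UNIV. c j * y $ j)"
proof -
  obtain H where H: "\<forall>j. H j \<in> forms 0" "\<forall>y. F y = (\<Sum>j\<in>UNIV. y $ j * H j y)"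
    using forms_Suc_decomp[OF assms] by auto
  have "\<forall>j. \<exists>c. H j = (\<lambda>_. c)" using H(1) by (auto elim: forms_0E)
  then obtain c where "\<And>j. H j = (\<lambda>_. c j)" by metis
  thus ?thesis using H(2) by (intro exI[of _ c]) (simp add: mult.commute)
qed

text \<open>\<open>B\<close> need not be symmetric, which is why both orders of the mixed term are
  carried along in the reduction below.\<close>

lemma forms_2_bilinear:
  assumes "Q \<in> forms 2"
  shows "\<exists>B. bilinear B \<and> (\<forall>y. Q y = B y y)"
proof -
  obtain G where G: "\<forall>i. G i \<in> forms (Suc 0)" "\<forall>y. Q y = (\<Sum>i\<in>UNIV. y $ i * G i y)"
    using forms_Suc_decomp[of Q "Suc 0"] assms by (auto simp: numeral_2_eq_2)
  have "\<exists>c. \<forall>y. G i y = (\<Sum>j\<in>UNIV. y $ j * c j)" for i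
    using forms_1_linear[of "G i"] G(1) by (simp add: mult.commute)
  then obtain c where c: "\<And>i y. G i y = (\<Sum>j\<in>UNIV. y $ j * c i j)" by metis
  have "bilinear (\<lambda>y z. \<Sum>i\<in>UNIV. y $ i * (\<Sum>j\<in>UNIV. z $ j * c i j))"
    unfolding bilinear_def
    by (intro conjI allI linearI) (simp_all add: algebra_simps sum.distrib sum_distrib_left)
  thus ?thesis using G(2) by (auto simp: c)
qed

text \<open>The family is multiplied by the Householder reflection that takes the \<open>r\<close>-th unit vector to a
  normalised dependence \<open>a\<close>; this preserves \<open>\<Sum>f. w f (w f)\<^sup>T\<close> and makes the \<open>r\<close>-th vector zero.
  The sign of \<open>a\<close> is chosen so that \<open>1 - a r > 0\<close>.\<close>

lemma quadratic_reduce_step: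
  fixes w :: "'f \<Rightarrow> real ^ 'v::finite"
  assumes "finite F" "CARD('v) < card F"
  shows "\<exists>F' w'. F' \<subset> F \<and> (\<forall>Q\<in>forms 2. (\<Sum>f\<in>F'. Q (w' f)) = (\<Sum>f\<in>F. Q (w f)))"
proof -
  have "\<not> indep_vecs UNIV (\<lambda>f i. w f $ i) F"
    using assms by (intro not_indep_vecs_if_card) auto
  then obtain \<beta> r where \<beta>: "\<forall>i. (\<Sum>f\<in>F. \<beta> f * w f $ i) = 0" "r \<in> F" "\<beta> r \<noteq> 0"
    by (auto simp: indep_vecs_def)
  define N where "N = sqrt (\<Sum>f\<in>F. (\<beta> f)\<^sup>2)"
  have "0 < (\<beta> r)\<^sup>2" using \<beta> by simp
  also have "\<dots> \<le> (\<Sum>f\<in>F. (\<beta> f)\<^sup>2)" using assms \<beta> by (intro member_le_sum) auto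
  finally have N: "N > 0" "N\<^sup>2 = (\<Sum>f\<in>F. (\<beta> f)\<^sup>2)" unfolding N_def by auto
  define a where "a f = - sgn (\<beta> r) * \<beta> f / N" for f
  have a1: "(\<Sum>f\<in>F. (a f)\<^sup>2) = 1"
  proof -
    have "(a f)\<^sup>2 = (\<beta> f)\<^sup>2 / N\<^sup>2" for f
      using \<beta>(3) by (simp add: a_def power_mult_distrib power_divide sgn_if)
    hence "(\<Sum>f\<in>F. (a f)\<^sup>2) = (\<Sum>f\<in>F. (\<beta> f)\<^sup>2) / N\<^sup>2" by (simp add: sum_divide_distrib)
    thus ?thesis using N(1) by (simp add: N(2)[symmetric])
  qed
  have ar: "a r < 0" using \<beta>(3) N by (auto simp: a_def sgn_if divide_neg_pos)
  have a0: "(\<Sum>f\<in>F. a f *\<^sub>R w f) = 0"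
  proof -
    have "(\<Sum>f\<in>F. a f *\<^sub>R w f) $ i = 0" for i
    proof -
      have "(\<Sum>f\<in>F. a f *\<^sub>R w f) $ i = - sgn (\<beta> r) / N * (\<Sum>f\<in>F. \<beta> f * w f $ i)"
        unfolding sum_component sum_distrib_left by (intro sum.cong) (auto simp: a_def)
      thus ?thesis using \<beta>(1) by simp
    qed
    thus ?thesis by (simp add: vec_eq_iff)
  qed
  define F' where "F' = F - {r}"
  have F': "finite F'" "r \<notin> F'" "F = insert r F'" using assms \<beta> by (auto simp: F'_def)
  \<comment> \<open>As the combination with coefficients \<open>a\<close> is zero, the reflection
    changes the vector at \<open>f\<close> into \<open>w f + c f *\<^sub>R w r\<close>.\<close>
  define c where "c f = a f / (1 - a r)" for f
  have c0: "(\<Sum>f\<in>F'. c f *\<^sub>R w f) = (- a r / (1 - a r)) *\<^sub>R w r"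
  proof -
    have "(\<Sum>f\<in>F'. a f *\<^sub>R w f) = - (a r *\<^sub>R w r)"
      using a0 F' by (simp add: eq_neg_iff_add_eq_0 add.commute)
    moreover have "(\<Sum>f\<in>F'. c f *\<^sub>R w f) = (1 / (1 - a r)) *\<^sub>R (\<Sum>f\<in>F'. a f *\<^sub>R w f)"
      by (simp add: c_def scaleR_sum_right)
    ultimately show ?thesis by simp
  qed
  have c2: "(\<Sum>f\<in>F'. (c f)\<^sup>2) = (1 + a r) / (1 - a r)"
  proof -
    have "(\<Sum>f\<in>F'. (a f)\<^sup>2) = 1 - (a r)\<^sup>2" using a1 F' by simp
    hence "(\<Sum>f\<in>F'. (c f)\<^sup>2) = (1 - (a r)\<^sup>2) / (1 - a r)\<^sup>2"
      by (simp add: c_def power_divide sum_divide_distrib[symmetric])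
    also have "\<dots> = ((1 + a r) * (1 - a r)) / ((1 - a r) * (1 - a r))"
      by (simp add: power2_eq_square algebra_simps)
    finally show ?thesis using ar by simp
  qed
  have "\<forall>Q\<in>forms 2. (\<Sum>f\<in>F'. Q (w f + c f *\<^sub>R w r)) = (\<Sum>f\<in>F. Q (w f))"
  proof
    fix Q :: "real ^ 'v \<Rightarrow> real"
    assume Q: "Q \<in> forms 2"
    obtain B where B: "bilinear B" "\<And>y. Q y = B y y" using forms_2_bilinear[OF Q] by blast
    note bil = bilinear_ladd[OF B(1)] bilinear_radd[OF B(1)] bilinear_lmul[OF B(1)] bilinear_rmul[OF B(1)]
    have l: "linear (\<lambda>y. B y z)" "linear (B z)" for z
      using B(1) by (auto simp: bilinear_def)
    have "Q (w f + c f *\<^sub>R w r) = Q (w f) + (B (c f *\<^sub>R w f) (w r) + B (w r) (c f *\<^sub>R w f))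
        + (c f)\<^sup>2 * Q (w r)" for f
      by (simp add: B(2) bil algebra_simps power2_eq_square)
    hence "(\<Sum>f\<in>F'. Q (w f + c f *\<^sub>R w r)) = (\<Sum>f\<in>F'. Q (w f))
        + (B (\<Sum>f\<in>F'. c f *\<^sub>R w f) (w r) + B (w r) (\<Sum>f\<in>F'. c f *\<^sub>R w f))
        + (\<Sum>f\<in>F'. (c f)\<^sup>2) * Q (w r)"
      by (simp add: sum.distrib sum_distrib_right linear_sum[OF l(1)] linear_sum[OF l(2)])
    also have "\<dots> = (\<Sum>f\<in>F'. Q (w f)) + (- 2 * a r / (1 - a r) + (1 + a r) / (1 - a r)) * Q (w r)"
      by (simp only: c0 c2 bil B(2)[symmetric] real_scaleR_def) (simp add: algebra_simps)
    \<comment> \<open>The total factor of \<open>Q (w r)\<close> is exactly the contribution of the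
      dropped index \<open>r\<close>.\<close>
    also have "- 2 * a r / (1 - a r) + (1 + a r) / (1 - a r) = 1"
    proof -
      have "- 2 * a r / (1 - a r) + (1 + a r) / (1 - a r) = (1 - a r) / (1 - a r)"
        unfolding add_divide_distrib[symmetric] by simp
      thus ?thesis using ar by simp
    qed
    finally show "(\<Sum>f\<in>F'. Q (w f + c f *\<^sub>R w r)) = (\<Sum>f\<in>F. Q (w f))"
      using F' by simp
  qed
  moreover have "F' \<subset> F" using F' by auto
  ultimately show ?thesis by (intro exI[of _ F'] exI[of _ "\<lambda>f. w f + c f *\<^sub>R w r"] conjI)
qed

text \<open>A sum of evaluations is a positive semidefinite functional on quadratic forms and needs
  no more terms than its matrix has rows.\<close>

lemma quadratic_reduce:
  fixes w :: "'f \<Rightarrow> real ^ 'v::finite"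
  assumes "finite F"
  shows "\<exists>(F' :: 'f set) w'. finite F' \<and> card F' \<le> CARD('v) \<and>
    (\<forall>Q\<in>forms 2. (\<Sum>f\<in>F'. Q (w' f)) = (\<Sum>f\<in>F. Q (w f)))"
  using assms
proof (induction F arbitrary: w rule: finite_psubset_induct)
  case (psubset F w)
  show ?case
  proof (cases "card F \<le> CARD('v)")
    case False
    hence "CARD('v) < card F" by simp
    from quadratic_reduce_step[OF psubset.hyps this, of w]
    obtain F1 and w1 :: "'f \<Rightarrow> real ^ 'v" where 1: "F1 \<subset> F" "\<forall>Q\<in>forms 2. (\<Sum>f\<in>F1. Q (w1 f)) = (\<Sum>f\<in>F. Q (w f))"
      by blast
    from psubset.IH[OF 1(1), of w1] obtain F' and w' :: "'f \<Rightarrow> real ^ 'v"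
      where F': "finite F'" "card F' \<le> CARD('v)"
      "\<forall>Q\<in>forms 2. (\<Sum>f\<in>F'. Q (w' f)) = (\<Sum>f\<in>F1. Q (w1 f))"
      by blast
    have "\<forall>Q\<in>forms 2. (\<Sum>f\<in>F'. Q (w' f)) = (\<Sum>f\<in>F. Q (w f))"
    proof
      fix Q :: "real ^ 'v \<Rightarrow> real"
      assume Q: "Q \<in> forms 2"
      show "(\<Sum>f\<in>F'. Q (w' f)) = (\<Sum>f\<in>F. Q (w f))"
        by (rule trans[OF bspec[OF F'(3) Q] bspec[OF 1(2) Q]])
    qed
    with F'(1,2) show ?thesis by (intro exI[of _ F'] exI[of _ w'] conjI)
  qed (use psubset.hyps in blast)
qed

section \<open>Forms vanishing at the zeros of a nonnegative form\<close>

lemma coord_power_in_forms: "(\<lambda>y. (y $ i) ^ m) \<in> forms m"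
  by (induction m) (auto dest: forms_coord[of _ _ i])

lemma forms_linear_mult:
  assumes "H \<in> forms m"
  shows "(\<lambda>y. (\<Sum>j\<in>UNIV. l j * y $ j) * H y) \<in> forms (Suc m)"
proof -
  have "(\<lambda>y. \<Sum>j\<in>UNIV. l j * (y $ j * H y)) \<in> forms (Suc m)"
    by (intro forms_sum forms_scale forms_coord assms)
  thus ?thesis by (simp add: sum_distrib_right mult.assoc)
qed

lemma linear_in_forms: "(\<lambda>y. \<Sum>j\<in>UNIV. l j * y $ j) \<in> forms (Suc 0)"
  using forms_linear_mult[of "\<lambda>_. 1" 0 l] by simp

lemma sum_axis [simp]: "(\<Sum>j\<in>UNIV. l j * axis i (1::real) $ j) = l i"
  by (simp add: axis_def if_distrib[of "\<lambda>x. _ * x"] cong: if_cong)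

text \<open>A zero of a nonnegative form is a global minimum.\<close>

lemma derivative_zero_of_nonneg_form:
  fixes p :: "real ^ 'v::finite \<Rightarrow> real"
  assumes "\<And>y. p y \<ge> 0" "p z = 0"
    and "(p has_derivative (\<lambda>h. \<Sum>i\<in>UNIV. h $ i * G i z)) (at z)"
  shows "G i z = 0"
proof -
  have "(\<lambda>h :: real ^ 'v. \<Sum>i\<in>UNIV. h $ i * G i z) = (\<lambda>_. 0)"
    using assms by (intro differential_zero_maxmin[of z UNIV p]) auto
  from fun_cong[OF this, of "axis i 1"] show ?thesis
    using sum_axis[of "\<lambda>j. G j z" i] by (simp add: mult.commute)
qed

text \<open>The products \<open>y $ j * q y\<close> together with \<open>r\<close> will be
  \<open>CARD('v) + 1\<close> independent forms that vanish at all zeros of \<open>p\<close>. They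
  come from partial derivatives of \<open>p\<close>, except when these are all proportional; then
  the zeros lie in a hyperplane, and multiples of its equation are used.\<close>

lemma vanishing_pair:
  fixes p :: "real ^ 'v::finite \<Rightarrow> real"
  assumes p: "p \<in> forms (Suc e)" and e: "e \<ge> 2" and card: "CARD('v) \<ge> 2"
    and nonneg: "\<And>y. p y \<ge> 0" and nz: "p y0 \<noteq> 0"
  shows "\<exists>q r. q \<in> forms e \<and> r \<in> forms (Suc e) \<and> (\<exists>y. q y \<noteq> 0)
    \<and> (\<forall>l. \<exists>y. r y \<noteq> (\<Sum>j\<in>UNIV. l j * y $ j) * q y)
    \<and> (\<forall>z. p z = 0 \<longrightarrow> q z = 0 \<and> r z = 0)"
proof -
  obtain G where G: "\<And>i. G i \<in> forms e"
      "\<And>y. (p has_derivative (\<lambda>h. \<Sum>i\<in>UNIV. h $ i * G i y)) (at y)"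
    using forms_has_derivative[OF p] by blast
  have Gz: "G i z = 0" if "p z = 0" for i z
    by (rule derivative_zero_of_nonneg_form[of p z G, OF nonneg that G(2)])
  have p0: "p 0 = 0" using forms_scaleR[OF p, of 0 0] by simp
  have "\<exists>l y. G l y \<noteq> 0"
  proof (rule ccontr)
    assume "\<not> ?thesis"
    hence "(p has_derivative (\<lambda>h. 0)) (at y)" for y using G(2)[of y] by simp
    then obtain c where "\<forall>y\<in>UNIV. p y = c"
      using has_derivative_zero_constant[of UNIV p] by auto
    thus False using p0 nz by simp
  qed
  then obtain l0 y1 where q: "G l0 y1 \<noteq> 0" by blast
  let ?lin = "\<lambda>l y :: real ^ 'v. \<Sum>j\<in>UNIV. l j * y $ j"
  show ?thesis
  proof (cases "\<exists>i l. \<forall>m. \<exists>y. y $ i * G l y \<noteq> ?lin m y * G l0 y")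
    case True
    then obtain i l where il: "\<forall>m. \<exists>y. y $ i * G l y \<noteq> ?lin m y * G l0 y" by blast
    show ?thesis
      by (rule exI[of _ "G l0"], rule exI[of _ "\<lambda>y. y $ i * G l y"])
        (use G(1) q il Gz in \<open>auto\<close>)
  next
    case False
    hence F: "\<And>i l. \<exists>m. \<forall>y. y $ i * G l y = ?lin m y * G l0 y" by blast
    obtain i j :: 'v where ij: "i \<noteq> j"
    proof -
      have "\<not> (\<forall>i j :: 'v. i = j)"
      proof
        assume eq: "\<forall>i j :: 'v. i = j"
        have "CARD('v) \<le> card {undefined :: 'v}"
          by (rule card_mono) (use eq in auto)
        thus False using card by simp
      qed
      thus thesis using that by blast
    qed
    have "\<exists>a. \<forall>y. G l y = a * G l0 y" for l
    proof -
      obtain m1 m2 where m: "\<forall>y. y $ i * G l y = ?lin m1 y * G l0 y"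
        "\<forall>y. y $ j * G l y = ?lin m2 y * G l0 y" using F by metis
      \<comment> \<open>Cancelling \<open>G l0\<close> equates two products of a coordinate and a
        linear form, which forces \<open>m1\<close> to be a multiple of the coordinate
        \<open>i\<close>.\<close>
      have "(\<lambda>y. y $ j * ?lin m1 y - y $ i * ?lin m2 y) \<in> forms (Suc (Suc 0))"
        by (intro forms_diff forms_coord linear_in_forms)
      moreover have "(y $ j * ?lin m1 y - y $ i * ?lin m2 y) * G l0 y = 0" for y
      proof -
        have "(y $ j * ?lin m1 y - y $ i * ?lin m2 y) * G l0 y
          = y $ j * (?lin m1 y * G l0 y) - y $ i * (?lin m2 y * G l0 y)" by (simp add: algebra_simps)
        also have "\<dots> = 0" using m(1)[rule_format, of y, symmetric] m(2)[rule_format, of y, symmetric]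
          by simp
        finally show ?thesis .
      qed
      ultimately have "(\<forall>y. y $ j * ?lin m1 y - y $ i * ?lin m2 y = 0) \<or> (\<forall>y. G l0 y = 0)"
        by (intro forms_no_zero_divisors[OF _ G(1)[of l0]])
      hence "\<forall>y. y $ j * ?lin m1 y - y $ i * ?lin m2 y = 0" using q by blast
      hence *: "y $ j * ?lin m1 y = y $ i * ?lin m2 y" for y by simp
      have m1j: "m1 j = 0"
        using *[of "axis j 1"] ij unfolding sum_axis by (simp add: axis_def)
      have m1: "m1 j' = 0" if "j' \<noteq> i" for j'
      proof (cases "j' = j")
        case False
        have "?lin m (axis j 1 + axis j' 1) = m j + m j'" for m
          by (simp add: distrib_left sum.distrib)
        thus ?thesis using *[of "axis j 1 + axis j' 1"] that ij m1j False
          by (simp only:) (simp add: axis_def)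
      qed (use m1j in simp)
      have lin: "?lin m1 y = m1 i * y $ i" for y
      proof -
        have "?lin m1 y = (\<Sum>j\<in>{i}. m1 j * y $ j)"
          by (rule sum.mono_neutral_right) (use m1 in auto)
        thus ?thesis by simp
      qed
      have "(\<lambda>y. G l y - m1 i * G l0 y) \<in> forms e"
        by (intro forms_diff forms_scale G(1))
      moreover have "(y $ i) ^ 1 * (G l y - m1 i * G l0 y) = 0" for y
        using m(1)[rule_format, of y] by (simp add: lin algebra_simps)
      moreover have "\<not> (\<forall>y :: real ^ 'v. (y $ i) ^ 1 = 0)"
        by (auto intro!: exI[of _ "axis i 1"] simp: axis_def)
      ultimately have "\<forall>y. G l y - m1 i * G l0 y = 0"
        using forms_no_zero_divisors[OF coord_power_in_forms[of i 1], of "\<lambda>y. G l y - m1 i * G l0 y" e]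
        by blast
      thus ?thesis by (intro exI[of _ "m1 i"]) simp
    qed
    \<comment> \<open>All partial derivatives are proportional, so \<open>p\<close> is a multiple of a power of a linear form.\<close>
    then obtain c where "\<forall>l. \<forall>y. G l y = c l * G l0 y" using choice[of "\<lambda>l a. \<forall>y. G l y = a * G l0 y"] by blast
    hence c: "\<And>l y. G l y = c l * G l0 y" by blast
    define a :: "real ^ 'v" where "a = (\<chi> l. c l)"
    have inner_a: "a \<bullet> y = ?lin c y" for y by (simp add: inner_vec_def a_def)
    have cl0: "c l0 = 1" using c[of l0 y1] q by (metis mult_cancel_right1)
    have der: "(p has_derivative (\<lambda>h. (a \<bullet> h) * G l0 y)) (at y)" for y
    proof -
      have "h $ i * G i y = c i * h $ i * G l0 y" for h i
        by (subst c) simp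
      hence "(\<Sum>i\<in>UNIV. h $ i * G i y) = (a \<bullet> h) * G l0 y" for h
        unfolding inner_a sum_distrib_right by (intro sum.cong refl)
      thus ?thesis using G(2)[of y] by simp
    qed
    \<comment> \<open>The derivative is a multiple of the inner product with \<open>a\<close>, so
      \<open>p\<close> is constant in all directions orthogonal to \<open>a\<close>.\<close>
    have shift: "p (y + u) = p y" if u: "a \<bullet> u = 0" for y u
    proof -
      have "((\<lambda>t. p (y + t *\<^sub>R u)) has_derivative (\<lambda>_. 0)) (at t)" for t
      proof -
        have "((\<lambda>t. y + t *\<^sub>R u) has_derivative (\<lambda>t. t *\<^sub>R u)) (at t)"
          by (auto intro!: derivative_eq_intros)
        from has_derivative_compose[OF this der] show ?thesis using u by simp
      qed
      then obtain k where "\<forall>t\<in>UNIV. p (y + t *\<^sub>R u) = k"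
        using has_derivative_zero_constant[of UNIV "\<lambda>t. p (y + t *\<^sub>R u)"] by auto
      hence "p (y + 1 *\<^sub>R u) = k" "p (y + 0 *\<^sub>R u) = k" by blast+
      thus ?thesis by simp
    qed
    have a0: "a \<bullet> a > 0"
      using cl0 by (auto simp: a_def vec_eq_iff intro!: exI[of _ l0])
    have proj: "p y = ((a \<bullet> y) / (a \<bullet> a)) ^ Suc e * p a" for y
    proof -
      let ?s = "(a \<bullet> y) / (a \<bullet> a)"
      have "p (?s *\<^sub>R a + (y - ?s *\<^sub>R a)) = p (?s *\<^sub>R a)"
        using a0 by (intro shift) (simp add: inner_diff_right)
      thus ?thesis using forms_scaleR[OF p, of ?s a] by simp
    qed
    have Z: "?lin c z = 0" if "p z = 0" for z
      using proj[of z] that nz proj[of y0] a0 by (auto simp: inner_a)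
    \<comment> \<open>Both forms contain the equation of the hyperplane as a factor. As
      \<open>e \<ge> 2\<close>, \<open>(y $ j) ^ e\<close> is not divisible by
      \<open>(y $ i) ^ (e - 1)\<close>, so \<open>r'\<close> is not a linear multiple of
      \<open>q'\<close>.\<close>
    define q' where "q' y = ?lin c y * (y $ i) ^ (e - 1)" for y :: "real ^ 'v"
    define r' where "r' y = ?lin c y * (y $ j) ^ e" for y :: "real ^ 'v"
    have lin_nz: "\<not> (\<forall>y :: real ^ 'v. ?lin c y = 0)"
      using cl0 sum_axis[of c l0] by (metis zero_neq_one)
    show ?thesis
    proof (rule exI[of _ q'], rule exI[of _ r'], intro conjI allI impI)
      show "q' \<in> forms e" using forms_linear_mult[OF coord_power_in_forms[of i "e - 1"], of c] e
        by (simp add: q'_def[abs_def])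
      show "r' \<in> forms (Suc e)" using forms_linear_mult[OF coord_power_in_forms[of j e], of c]
        by (simp add: r'_def[abs_def])
      show "\<exists>y. q' y \<noteq> 0"
      proof (rule ccontr)
        assume "\<not> ?thesis"
        hence "(\<forall>y. ?lin c y = 0) \<or> (\<forall>y :: real ^ 'v. (y $ i) ^ (e - 1) = 0)"
          by (intro forms_no_zero_divisors[OF linear_in_forms coord_power_in_forms]) (simp add: q'_def)
        hence "(axis i (1::real) $ i) ^ (e - 1) = 0" using lin_nz by blast
        thus False by (simp add: axis_def)
      qed
      show "\<exists>y. r' y \<noteq> ?lin l y * q' y" for l
      proof (rule ccontr)
        assume "\<not> ?thesis"
        hence "\<And>y. ?lin c y * ((y $ j) ^ e - ?lin l y * (y $ i) ^ (e - 1)) = 0"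
          by (simp add: q'_def r'_def algebra_simps)
        moreover have "(\<lambda>y. (y $ j) ^ e - ?lin l y * (y $ i) ^ (e - 1)) \<in> forms e"
          using forms_linear_mult[OF coord_power_in_forms[of i "e - 1"], of l] e
          by (intro forms_diff coord_power_in_forms) simp
        ultimately have "(\<forall>y. ?lin c y = 0) \<or> (\<forall>y. (y $ j) ^ e - ?lin l y * (y $ i) ^ (e - 1) = 0)"
          by (intro forms_no_zero_divisors[OF linear_in_forms])
        hence "\<forall>y. (y $ j) ^ e - ?lin l y * (y $ i) ^ (e - 1) = 0" using lin_nz by blast
        from this[rule_format, of "axis j 1"] show False
          using ij e by (simp add: axis_def zero_power)
      qed
    qed (use Z in \<open>auto simp: q'_def r'_def\<close>)
  qed
qed

text \<open>The coefficient vectors of \<open>r\<close> and of the products \<open>y\<^sub>j q\<close> are orthogonal to the evaluation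
  vectors at the points of \<open>S\<close>.\<close>

lemma card_indep_zeros:
  fixes S :: "(real ^ 'v::finite) set"
  assumes q: "q \<in> forms e" "q y0 \<noteq> 0" and r: "r \<in> forms (Suc e)"
    and ind: "\<And>l. \<exists>y. r y \<noteq> (\<Sum>j\<in>UNIV. l j * y $ j) * q y"
    and S: "finite S" "\<And>z. z \<in> S \<Longrightarrow> q z = 0 \<and> r z = 0"
    and indep: "indep_vecs (exps (Suc e)) (\<lambda>z b. mon b z) S"
  shows "card S + CARD('v) + 1 \<le> card (exps (Suc e) :: ('v \<Rightarrow> nat) set)"
proof (rule ccontr)
  let ?I = "exps (Suc e) :: ('v \<Rightarrow> nat) set"
  assume small: "\<not> ?thesis"
  obtain cr where cr: "r = evalf (Suc e) cr" using r by (auto elim!: formsE)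
  have "\<exists>c. (\<lambda>y. y $ j * q y) = evalf (Suc e) c" for j
    using forms_coord[OF q(1), of j] by (auto elim!: formsE)
  then obtain cq where cq: "\<And>j. (\<lambda>y. y $ j * q y) = evalf (Suc e) (cq j)" by metis
  \<comment> \<open>Evaluation vectors at the points of \<open>S\<close>, followed by the
    coefficient vectors of \<open>r\<close> and of the products \<open>y $ j * q y\<close>. If the
    bound failed, there would be more vectors than coordinates.\<close>
  define u :: "(real ^ 'v) + 'v option \<Rightarrow> ('v \<Rightarrow> nat) \<Rightarrow> real" where
    "u f b = (case f of Inl z \<Rightarrow> mon b z | Inr None \<Rightarrow> cr b | Inr (Some j) \<Rightarrow> cq j b)" for f b
  have "card (S <+> (UNIV :: 'v option set)) = card S + (CARD('v) + 1)"
    using S(1) by (simp add: card_Plus card_UNIV_option)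
  hence "\<not> indep_vecs ?I u (S <+> UNIV)"
    using S(1) small by (intro not_indep_vecs_if_card) auto
  then obtain \<alpha> f0 where \<alpha>: "\<And>b. b \<in> ?I \<Longrightarrow> (\<Sum>f\<in>S <+> UNIV. \<alpha> f * u f b) = 0"
      "f0 \<in> S <+> UNIV" "\<alpha> f0 \<noteq> 0"
    unfolding indep_vecs_def by blast
  define \<gamma> where "\<gamma> = \<alpha> (Inr None)"
  define \<beta> where "\<beta> j = \<alpha> (Inr (Some j))" for j
  define cQ where "cQ b = \<gamma> * cr b + (\<Sum>j\<in>UNIV. \<beta> j * cq j b)" for b
  have split: "(\<Sum>f\<in>S <+> UNIV. \<alpha> f * u f b) = (\<Sum>z\<in>S. \<alpha> (Inl z) * mon b z) + cQ b" for b
    using S(1) by (simp add: sum.Plus UNIV_option_conv sum.reindex u_def cQ_def \<gamma>_def \<beta>_def)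
  have Q: "evalf (Suc e) cQ y = \<gamma> * r y + (\<Sum>j\<in>UNIV. \<beta> j * y $ j) * q y" for y
  proof -
    have "evalf (Suc e) cQ y = \<gamma> * evalf (Suc e) cr y + (\<Sum>j\<in>UNIV. \<beta> j * evalf (Suc e) (cq j) y)"
      by (simp add: evalf_def cQ_def sum.distrib sum_distrib_left sum_distrib_right algebra_simps)
        (rule sum.swap)
    thus ?thesis by (simp add: cr cq[symmetric] sum_distrib_right mult.assoc)
  qed
  \<comment> \<open>The relation is paired with \<open>cQ\<close> itself: its evaluation part turns
    into values of the form \<open>cQ\<close> at points of \<open>S\<close>, which are zero, so that
    a sum of squares must vanish.\<close>
  have "(\<Sum>b\<in>?I. cQ b * ((\<Sum>z\<in>S. \<alpha> (Inl z) * mon b z) + cQ b)) = 0"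
    using \<alpha>(1) split by (intro sum.neutral) auto
  also have "(\<Sum>b\<in>?I. cQ b * ((\<Sum>z\<in>S. \<alpha> (Inl z) * mon b z) + cQ b))
      = (\<Sum>b\<in>?I. \<Sum>z\<in>S. \<alpha> (Inl z) * (cQ b * mon b z)) + (\<Sum>b\<in>?I. (cQ b)\<^sup>2)"
    by (simp add: algebra_simps sum.distrib sum_distrib_left power2_eq_square)
  also have "(\<Sum>b\<in>?I. \<Sum>z\<in>S. \<alpha> (Inl z) * (cQ b * mon b z))
      = (\<Sum>z\<in>S. \<alpha> (Inl z) * evalf (Suc e) cQ z)"
    by (subst sum.swap) (simp add: evalf_def sum_distrib_left)
  also have "\<dots> = 0" using S(2) by (intro sum.neutral) (simp add: Q)
  finally have "(\<Sum>b\<in>?I. (cQ b)\<^sup>2) = 0" by simp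
  hence cQ0: "\<And>b. b \<in> ?I \<Longrightarrow> cQ b = 0" by (subst (asm) sum_nonneg_eq_0_iff) auto
  hence Q0: "\<gamma> * r y + (\<Sum>j\<in>UNIV. \<beta> j * y $ j) * q y = 0" for y
    unfolding Q[symmetric] by (simp add: evalf_def)
  have \<gamma>: "\<gamma> = 0"
  proof (rule ccontr)
    assume g: "\<gamma> \<noteq> 0"
    have "r y = (\<Sum>j\<in>UNIV. (- \<beta> j / \<gamma>) * y $ j) * q y" for y
    proof -
      let ?s = "\<Sum>j\<in>UNIV. \<beta> j * y $ j"
      have s: "(\<Sum>j\<in>UNIV. (- \<beta> j / \<gamma>) * y $ j) = - ?s / \<gamma>"
        by (simp add: sum_negf sum_divide_distrib)
      have "\<gamma> * r y = - ?s * q y" using Q0[of y] by simp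
      moreover have "r y = \<gamma> * r y / \<gamma>" using g by simp
      ultimately show ?thesis unfolding s by simp
    qed
    thus False using ind[of "\<lambda>j. - \<beta> j / \<gamma>"] by blast
  qed
  have "(\<forall>y :: real ^ 'v. (\<Sum>j\<in>UNIV. \<beta> j * y $ j) = 0) \<or> (\<forall>y. q y = 0)"
    using Q0 \<gamma> by (intro forms_no_zero_divisors[OF linear_in_forms q(1)]) simp
  hence "\<forall>y :: real ^ 'v. (\<Sum>j\<in>UNIV. \<beta> j * y $ j) = 0" using q(2) by blast
  hence \<beta>: "\<beta> j = 0" for j using sum_axis[of \<beta> j] by metis
  have "(\<Sum>z\<in>S. \<alpha> (Inl z) * mon b z) = 0" if "b \<in> ?I" for b
    using \<alpha>(1)[OF that] split[of b] cQ0[OF that] by simp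
  hence "\<forall>z\<in>S. \<alpha> (Inl z) = 0"
    using spec[OF indep[unfolded indep_vecs_def], of "\<lambda>z. \<alpha> (Inl z)"] by blast
  moreover have "\<alpha> (Inr x) = 0" for x
    using \<gamma> \<beta> by (cases x) (auto simp: \<gamma>_def \<beta>_def)
  ultimately have "\<alpha> f = 0" if "f \<in> S <+> UNIV" for f
    using that by (cases f) auto
  thus False using \<alpha>(2,3) by blast
qed

section \<open>Reducing the number of evaluation points\<close>

lemma evalf_diff: "evalf d (\<lambda>b. c b - s * c' b) y = evalf d c y - s * evalf d c' y"
  by (simp add: evalf_def sum_subtractf sum_distrib_left algebra_simps)

section \<open>Compactness of the normalised coefficients\<close>

lemma continuous_on_evalf:
  assumes "continuous_on S f" "continuous_on S g"
  shows "continuous_on S (\<lambda>x. evalf d (f x) (g x))"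
  unfolding evalf_def by (intro continuous_on_sum continuous_on_mult continuous_on_mon
    continuous_on_product_then_coordinatewise[OF assms(1)] assms(2))

text \<open>Fixing the coefficients outside \<open>exps d\<close> to be zero places the whole set in
  a compact cube.\<close>

definition unit_coeffs :: "nat \<Rightarrow> (('v::finite \<Rightarrow> nat) \<Rightarrow> real) set" where
  "unit_coeffs d = {c. (\<forall>b. b \<notin> exps d \<longrightarrow> c b = 0) \<and> (\<Sum>b\<in>exps d. \<bar>c b\<bar>) = 1}"

text \<open>Tychonoff's theorem; it serves for coefficient functions, weights and sequences of forms
  alike.\<close>

lemma compact_Pi_UNIV:
  fixes S :: "'i \<Rightarrow> 'a::topological_space set"
  assumes "\<And>i. compact (S i)"
  shows "compact (Pi UNIV S)"
proof -
  have "compactin (product_topology (\<lambda>_. euclidean) UNIV) (PiE UNIV S)"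
    using assms by (simp add: compactin_PiE)
  thus ?thesis by (simp add: euclidean_product_topology PiE_UNIV_domain Pi_def)
qed

lemma compact_unit_coeffs: "compact (unit_coeffs d :: (('v::finite \<Rightarrow> nat) \<Rightarrow> real) set)"
proof -
  let ?B = "Pi UNIV (\<lambda>_. {-1..1}) :: (('v \<Rightarrow> nat) \<Rightarrow> real) set"
  have c: "continuous_on UNIV (\<lambda>c :: ('v \<Rightarrow> nat) \<Rightarrow> real. c b)" for b
    by simp
  have "closed (\<Inter>b\<in>- exps d. {c :: ('v \<Rightarrow> nat) \<Rightarrow> real. c b = 0})"
    by (intro closed_INT ballI closed_Collect_eq c continuous_on_const)
  moreover have "closed {c :: ('v \<Rightarrow> nat) \<Rightarrow> real. (\<Sum>b\<in>exps d. \<bar>c b\<bar>) = 1}"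
    by (intro closed_Collect_eq continuous_on_sum continuous_on_rabs c continuous_on_const)
  ultimately have "closed (unit_coeffs d :: (('v \<Rightarrow> nat) \<Rightarrow> real) set)"
  proof -
    have eq: "unit_coeffs d = (\<Inter>b\<in>- exps d. {c :: ('v \<Rightarrow> nat) \<Rightarrow> real. c b = 0})
      \<inter> {c. (\<Sum>b\<in>exps d. \<bar>c b\<bar>) = 1}" by (auto simp: unit_coeffs_def)
    show ?thesis unfolding eq by (intro closed_Int) fact+
  qed
  moreover have "compact ?B" by (intro compact_Pi_UNIV) simp
  moreover have "unit_coeffs d \<subseteq> ?B"
  proof (intro subsetI Pi_I)
    fix c :: "('v \<Rightarrow> nat) \<Rightarrow> real" and b assume c: "c \<in> unit_coeffs d"
    have "\<bar>c b\<bar> \<le> 1"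
    proof (cases "b \<in> exps d")
      case True
      hence "\<bar>c b\<bar> \<le> (\<Sum>b\<in>exps d. \<bar>c b\<bar>)" by (intro member_le_sum) auto
      thus ?thesis using c by (simp add: unit_coeffs_def)
    qed (use c in \<open>simp add: unit_coeffs_def\<close>)
    thus "c b \<in> {-1..1}" by auto
  qed
  ultimately show ?thesis by (metis compact_Int_closed inf.absorb2)
qed

lemma unit_coeffs_normalise:
  fixes c :: "('v::finite \<Rightarrow> nat) \<Rightarrow> real"
  assumes "evalf d c y0 \<noteq> 0"
  obtains s c' where "s > 0" "c' \<in> unit_coeffs d" "\<And>y. evalf d c y = s * evalf d c' y"
proof -
  define s where "s = (\<Sum>b\<in>exps d. \<bar>c b\<bar>)"
  have s: "s > 0"
  proof -
    have "s \<noteq> 0"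
    proof
      assume "s = 0"
      hence "\<forall>b\<in>exps d. \<bar>c b\<bar> = 0" unfolding s_def by (subst (asm) sum_nonneg_eq_0_iff) auto
      thus False using assms by (simp add: evalf_def)
    qed
    moreover have "s \<ge> 0" unfolding s_def by (intro sum_nonneg) simp
    ultimately show ?thesis by simp
  qed
  define c' where "c' b = (if b \<in> exps d then c b / s else 0)" for b
  have "(\<Sum>b\<in>exps d. \<bar>c' b\<bar>) = (\<Sum>b\<in>exps d. \<bar>c b\<bar>) / s"
    using s by (simp add: c'_def sum_divide_distrib)
  hence "c' \<in> unit_coeffs d" using s by (simp add: unit_coeffs_def c'_def s_def[symmetric])
  moreover have "evalf d c y = s * evalf d c' y" for y
    using s by (simp add: evalf_def c'_def sum_distrib_left)
  ultimately show thesis using that s by blast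
qed

lemma nonneg_from_sphere:
  assumes F: "F \<in> forms d" and s: "\<And>y :: real ^ 'v::finite. norm y = 1 \<Longrightarrow> F y \<ge> 0" and d: "d > 0"
  shows "F y \<ge> 0"
proof (cases "y = 0")
  case True
  have "F (0 *\<^sub>R 0) = 0 ^ d * F 0" by (rule forms_scaleR[OF F])
  thus ?thesis using d True by (simp add: zero_power)
next
  case False
  have "F y = F (norm y *\<^sub>R ((1 / norm y) *\<^sub>R y))" using False by simp
  also have "\<dots> = norm y ^ d * F ((1 / norm y) *\<^sub>R y)" by (rule forms_scaleR[OF F])
  also have "\<dots> \<ge> 0" using False by (intro mult_nonneg_nonneg s) auto
  finally show ?thesis .
qed

text \<open>The form \<open>p\<close> maximises \<open>p x\<^sub>0 / L p\<close> over the nonnegative forms, where \<open>L\<close> is the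
  functional that \<open>minimax_cover\<close> provides; subtracting a small multiple of a form \<open>Q\<close> with
  \<open>L Q > 0\<close> that is negative on the zeros of \<open>p\<close> and at \<open>x\<^sub>0\<close> would increase the quotient.\<close>

lemma extremal_nonneg_form:
  fixes K :: "(('v::finite \<Rightarrow> nat) \<Rightarrow> real) set" and x0 :: "real ^ 'v"
  assumes k: "k \<ge> 1" and x0: "x0 \<noteq> 0"
    and LK: "\<And>c. c \<in> K \<Longrightarrow> (\<Sum>y\<in>F. w y * evalf (2 * k) c y) > 0"
    and nonneg: "\<And>c. c \<in> unit_coeffs (2 * k) \<Longrightarrow> (\<And>y. evalf (2 * k) c y \<ge> 0) \<Longrightarrow> c \<in> K"
  obtains p where "p \<in> forms (2 * k)" "\<And>y. p y \<ge> 0" "p x0 \<noteq> 0"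
    "\<And>c. c \<in> K \<Longrightarrow> \<exists>y\<in>insert x0 {z. p z = 0}. evalf (2 * k) c y > 0"
proof -
  let ?d = "2 * k"
  define L where "L c = (\<Sum>y\<in>F. w y * evalf ?d c y)" for c :: "('v \<Rightarrow> nat) \<Rightarrow> real"
  have L_diff: "L (\<lambda>b. c b - s * c' b) = L c - s * L c'" for c s c'
    by (simp add: L_def evalf_diff sum_subtractf sum_distrib_left algebra_simps)
  have L_eq: "L c = s * L c'" if "\<And>y. evalf ?d c y = s * evalf ?d c' y" for c s c'
    by (simp add: L_def that sum_distrib_left mult.left_commute)
  define N where "N = unit_coeffs ?d \<inter> (\<Inter>y. {c :: ('v \<Rightarrow> nat) \<Rightarrow> real. 0 \<le> evalf ?d c y})"
  have cev: "continuous_on S (\<lambda>c :: ('v \<Rightarrow> nat) \<Rightarrow> real. evalf ?d c y)" for S y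
    by (intro continuous_on_evalf continuous_on_id continuous_on_const)
  have NK: "c \<in> K" if "c \<in> N" for c
    using that by (intro nonneg) (auto simp: N_def)
  have compN: "compact N" unfolding N_def
    by (intro compact_Int_closed compact_unit_coeffs closed_INT ballI closed_Collect_le cev continuous_on_const)
  \<comment> \<open>The sum of the even powers of the coordinates is positive off the origin. It
    shows that \<open>N\<close> is nonempty and later perturbs \<open>c\<close>.\<close>
  have "(\<lambda>y :: real ^ 'v. \<Sum>i\<in>UNIV. (y $ i) ^ ?d) \<in> forms ?d"
    by (intro forms_sum coord_power_in_forms)
  then obtain cq where "(\<lambda>y :: real ^ 'v. \<Sum>i\<in>UNIV. (y $ i) ^ ?d) = evalf ?d cq" by (rule formsE)
  hence cq: "evalf ?d cq y = (\<Sum>i\<in>UNIV. (y $ i) ^ ?d)" for y by (simp add: fun_eq_iff)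
  have cq_nonneg: "evalf ?d cq y \<ge> 0" for y unfolding cq by (intro sum_nonneg) simp
  have cq_pos: "evalf ?d cq y > 0" if "y \<noteq> 0" for y
  proof -
    have "\<exists>i. y $ i \<noteq> 0" using that by (simp add: vec_eq_iff)
    then obtain i where "y $ i \<noteq> 0" ..
    thus ?thesis unfolding cq by (intro sum_pos2[of _ i]) (auto simp: zero_less_power_eq)
  qed
  obtain s c1 where c1: "s > 0" "c1 \<in> unit_coeffs ?d" "\<And>y. evalf ?d cq y = s * evalf ?d c1 y"
    using unit_coeffs_normalise[of ?d cq x0] cq_pos[OF x0] by (metis less_irrefl)
  have "evalf ?d c1 y \<ge> 0" for y
    using cq_nonneg[of y] c1(1) unfolding c1(3) by (simp add: zero_le_mult_iff)
  hence c1N: "c1 \<in> N" using c1(2) by (auto simp: N_def)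
  have c1x0: "evalf ?d c1 x0 > 0"
    using cq_pos[OF x0] c1(1) unfolding c1(3) by (simp add: zero_less_mult_iff)
  have LN: "L c > 0" if "c \<in> N" for c using LK[OF NK[OF that]] by (simp add: L_def)
  have "continuous_on N (\<lambda>c. evalf ?d c x0 / L c)"
  proof (intro continuous_on_divide cev ballI)
    show "continuous_on N L" unfolding L_def
      by (intro continuous_on_sum continuous_on_mult cev continuous_on_const)
    show "L c \<noteq> 0" if "c \<in> N" for c using LN[OF that] by simp
  qed
  then obtain c0 where c0: "c0 \<in> N" "\<And>c. c \<in> N \<Longrightarrow> evalf ?d c x0 / L c \<le> evalf ?d c0 x0 / L c0"
    using continuous_attains_sup[OF compN] c1N by blast
  define M where "M = evalf ?d c0 x0 / L c0"
  define p where "p = evalf ?d c0"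
  have M: "M > 0"
  proof -
    have "0 < evalf ?d c1 x0 / L c1" using c1x0 LN[OF c1N] by simp
    also have "\<dots> \<le> M" unfolding M_def by (rule c0(2)[OF c1N])
    finally show ?thesis .
  qed
  \<comment> \<open>Scaling extends the maximality of \<open>c0\<close> from \<open>N\<close> to all
    nonnegative forms.\<close>
  have le: "evalf ?d c x0 \<le> M * L c" if nn: "\<And>y. evalf ?d c y \<ge> 0" for c
  proof (cases "\<exists>y. evalf ?d c y \<noteq> 0")
    case True
    then obtain y0 where "evalf ?d c y0 \<noteq> 0" by blast
    then obtain s c' where c': "s > 0" "c' \<in> unit_coeffs ?d" "\<And>y. evalf ?d c y = s * evalf ?d c' y"
      by (rule unit_coeffs_normalise) blast
    have "evalf ?d c' y \<ge> 0" for y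
      using nn[of y] c'(1) unfolding c'(3) by (simp add: zero_le_mult_iff)
    hence "c' \<in> N" using c'(2) by (auto simp: N_def)
    hence "evalf ?d c' x0 \<le> M * L c'"
      using c0(2)[of c'] LN[of c'] by (simp add: M_def pos_divide_le_eq)
    hence "s * evalf ?d c' x0 \<le> s * (M * L c')" using c'(1) by simp
    thus ?thesis unfolding c'(3) L_eq[OF c'(3)] by (simp only: mult.left_commute)
  next
    case False
    thus ?thesis by (simp add: L_def)
  qed
  have p: "p \<in> forms ?d" "\<And>y. p y \<ge> 0" using c0(1) by (auto simp: p_def N_def)
  have px0: "p x0 = M * L c0" using LN[OF c0(1)] by (simp add: M_def p_def)
  have "p x0 \<noteq> 0" using px0 M LN[OF c0(1)] by simp
  moreover have "\<exists>y\<in>insert x0 {z. p z = 0}. evalf ?d c y > 0" if c: "c \<in> K" for c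
  proof (rule ccontr)
    assume "\<not> ?thesis"
    hence neg: "\<And>y. y = x0 \<or> p y = 0 \<Longrightarrow> evalf ?d c y \<le> 0" by force
    have Lq: "L cq > 0"
      using le[OF cq_nonneg] cq_pos[OF x0] M by (meson less_le_trans zero_less_mult_pos)
    have Lc: "L c > 0" using LK[OF c] by (simp add: L_def)
    \<comment> \<open>Half of \<open>L c\<close> is kept, so \<open>c'\<close> stays positive under
      \<open>L\<close> while it becomes strictly negative at \<open>x0\<close> and at the nonzero
      zeros of \<open>p\<close>.\<close>
    define \<eta> where "\<eta> = L c / (2 * L cq)"
    have \<eta>: "\<eta> > 0" using Lc Lq by (simp add: \<eta>_def)
    define c' where "c' = (\<lambda>b. c b - \<eta> * cq b)"
    have Lc': "L c' > 0"
      unfolding c'_def L_diff using Lq Lc by (simp add: \<eta>_def)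
    have Q: "evalf ?d c' y < 0" if "y \<noteq> 0" "y = x0 \<or> p y = 0" for y
      using neg[OF that(2)] mult_pos_pos[OF \<eta> cq_pos[OF that(1)]] by (simp add: c'_def evalf_diff)
    \<comment> \<open>On the part of the sphere where \<open>c'\<close> is nonnegative,
      \<open>p\<close> is positive, so compactness bounds \<open>c'\<close> by a multiple of
      \<open>p\<close> there.\<close>
    define A where "A = sphere (0 :: real ^ 'v) 1 \<inter> {y. 0 \<le> evalf ?d c' y}"
    have cont: "continuous_on S p" "continuous_on S (evalf ?d c')" for S
      using forms_continuous[OF p(1)] forms_continuous[OF evalf_in_forms] by auto
    have A: "compact A" unfolding A_def
      by (intro compact_Int_closed compact_sphere closed_Collect_le cont continuous_on_const)
    have pA: "p y > 0" if "y \<in> A" for y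
    proof -
      have "y \<noteq> 0" "evalf ?d c' y \<ge> 0" using that by (auto simp: A_def)
      hence "p y \<noteq> 0" using Q[of y] by auto
      thus ?thesis using p(2)[of y] by simp
    qed
    have "\<exists>m\<ge>0. \<forall>y\<in>A. evalf ?d c' y \<le> m * p y"
    proof (cases "A = {}")
      case False
      have "continuous_on A (\<lambda>y. evalf ?d c' y / p y)"
        using pA by (intro continuous_on_divide cont) force
      then obtain y0 where y0: "y0 \<in> A" "\<And>y. y \<in> A \<Longrightarrow> evalf ?d c' y / p y \<le> evalf ?d c' y0 / p y0"
        using continuous_attains_sup[OF A False] by blast
      show ?thesis
      proof (intro exI[of _ "evalf ?d c' y0 / p y0"] conjI ballI)
        show "evalf ?d c' y0 / p y0 \<ge> 0" using y0(1) pA[of y0] by (simp add: A_def)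
        show "evalf ?d c' y \<le> evalf ?d c' y0 / p y0 * p y" if "y \<in> A" for y
          using y0(2)[OF that] pA[OF that] by (simp add: pos_divide_le_eq)
      qed
    qed auto
    then obtain m where m: "m \<ge> 0" "\<And>y. y \<in> A \<Longrightarrow> evalf ?d c' y \<le> m * p y" by blast
    define \<epsilon> where "\<epsilon> = 1 / (m + 1)"
    have \<epsilon>: "\<epsilon> > 0" "\<epsilon> * m \<le> 1" using m(1) by (auto simp: \<epsilon>_def)
    have "evalf ?d (\<lambda>b. c0 b - \<epsilon> * c' b) y \<ge> 0" for y
    proof (rule nonneg_from_sphere[OF evalf_in_forms])
      fix y :: "real ^ 'v" assume y: "norm y = 1"
      show "evalf ?d (\<lambda>b. c0 b - \<epsilon> * c' b) y \<ge> 0"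
      proof (cases "y \<in> A")
        case True
        have "\<epsilon> * evalf ?d c' y \<le> \<epsilon> * (m * p y)" using m(2)[OF True] \<epsilon>(1) by simp
        also have "\<dots> = (\<epsilon> * m) * p y" by simp
        also have "\<dots> \<le> 1 * p y" using \<epsilon>(2) p(2) by (intro mult_right_mono)
        finally show ?thesis by (simp add: evalf_diff p_def)
      next
        case False
        hence "evalf ?d c' y < 0" using y by (auto simp: A_def)
        hence "\<epsilon> * evalf ?d c' y < 0" using \<epsilon>(1) by (simp add: mult_pos_neg)
        thus ?thesis using p(2)[of y] by (simp add: evalf_diff p_def)
      qed
    qed (use k in simp)
    \<comment> \<open>Subtracting \<open>\<epsilon>\<close> times \<open>c'\<close> raises the value
      at \<open>x0\<close> and lowers that of \<open>L\<close>, against the maximality of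
      \<open>M\<close>.\<close>
    from le[OF this] have "p x0 - \<epsilon> * evalf ?d c' x0 \<le> M * (L c0 - \<epsilon> * L c')"
      by (simp only: evalf_diff L_diff p_def)
    hence "M * (\<epsilon> * L c') \<le> \<epsilon> * evalf ?d c' x0" using px0 by (simp add: algebra_simps)
    moreover have "M * (\<epsilon> * L c') > 0" using M \<epsilon>(1) Lc' by simp
    moreover have "\<epsilon> * evalf ?d c' x0 < 0" using Q[OF x0] \<epsilon>(1) by (simp add: mult_pos_neg)
    ultimately show False by linarith
  qed
  ultimately show thesis using that p by blast
qed

text \<open>Listing the index type turns exponents into lists of fixed length and fixed sum, whose
  number is known.\<close>

lemma card_exps: "card (exps d :: ('v::finite \<Rightarrow> nat) set) = (d + CARD('v) - 1) choose d"
proof -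
  obtain vs :: "'v list" where vs: "set vs = UNIV" "distinct vs"
    using finite_distinct_list[OF finite] by blast
  have len: "length vs = CARD('v)" using vs distinct_card by metis
  have "bij_betw (\<lambda>b. map b vs) (exps d) {l :: nat list. length l = CARD('v) \<and> sum_list l = d}"
    unfolding bij_betw_def
  proof
    show "inj_on (\<lambda>b. map b vs) (exps d)"
      using vs(1) by (intro inj_onI) (auto simp: fun_eq_iff)
    show "(\<lambda>b. map b vs) ` exps d = {l. length l = CARD('v) \<and> sum_list l = d}"
    proof (intro equalityI subsetI)
      fix l assume "l \<in> (\<lambda>b. map b vs) ` exps d"
      then obtain b where b: "l = map b vs" "b \<in> exps d" by auto
      have "sum_list (map b vs) = (\<Sum>i\<in>UNIV. b i)"
        using vs by (metis sum_list_distinct_conv_sum_set)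
      thus "l \<in> {l. length l = CARD('v) \<and> sum_list l = d}" using b len by (simp add: exps_def)
    next
      fix l assume l: "l \<in> {l. length l = CARD('v) \<and> sum_list l = d}"
      define b where "b i = the (map_of (zip vs l) i)" for i
      have eq: "map b vs = l"
      proof (rule nth_equalityI)
        fix j assume "j < length (map b vs)"
        thus "map b vs ! j = l ! j"
          using l len vs(2) by (simp add: b_def map_of_zip_nth)
      qed (use l len in simp)
      have "(\<Sum>i\<in>UNIV. b i) = sum_list (map b vs)"
        using vs by (metis sum_list_distinct_conv_sum_set)
      hence "b \<in> exps d" using eq l by (simp add: exps_def)
      thus "l \<in> (\<lambda>b. map b vs) ` exps d" using eq by force
    qed
  qed
  thus ?thesis using bij_betw_same_card card_length_sum_list by metis
qed

text \<open>For \<open>k = 1\<close> the rank reduction gives at most \<open>CARD('v)\<close>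
  points; otherwise the points are \<open>x0\<close> and independent zeros of an extremal form.
  Indices and points are separated by the map \<open>y\<close> because the rank reduction moves the
  vectors.\<close>

lemma few_points:
  fixes K :: "(('v::finite \<Rightarrow> nat) \<Rightarrow> real) set"
  assumes k: "k \<ge> 1" and v: "CARD('v) \<ge> 2" and kv: "\<not> (k = 1 \<and> CARD('v) = 2)"
    and K: "compact K"
    and conv: "\<And>c c' t. \<lbrakk>c \<in> K; c' \<in> K; 0 \<le> t; t \<le> 1\<rbrakk> \<Longrightarrow> (\<lambda>b. c b + t * (c' b - c b)) \<in> K"
    and pos: "\<And>c. c \<in> K \<Longrightarrow> \<exists>y. evalf (2 * k) c y > 0"
    and nonneg: "\<And>c. c \<in> unit_coeffs (2 * k) \<Longrightarrow> (\<And>y. evalf (2 * k) c y \<ge> 0) \<Longrightarrow> c \<in> K"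
  shows "\<exists>(F :: (real ^ 'v) set) w y. finite F \<and>
    card F + CARD('v) \<le> card (exps (2 * k) :: ('v \<Rightarrow> nat) set) \<and>
    (\<forall>f\<in>F. w f \<ge> 0) \<and> (\<forall>c\<in>K. (\<Sum>f\<in>F. w f * evalf (2 * k) c (y f)) > 0)"
proof -
  let ?d = "2 * k"
  have mm: "\<exists>F w. finite F \<and> F \<subseteq> T \<and> (\<forall>y\<in>F. w y \<ge> 0) \<and> (\<forall>c\<in>K. (\<Sum>y\<in>F. w y * evalf ?d c y) > 0)"
    if T: "\<And>c. c \<in> K \<Longrightarrow> \<exists>y\<in>T. evalf ?d c y > 0" for T
  proof (rule minimax_cover[OF K])
    fix c c' t assume "c \<in> K" "c' \<in> K" "0 \<le> t" "t \<le> (1::real)"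
    from conv[OF this] show "\<exists>c''\<in>K. \<forall>y\<in>T. evalf ?d c'' y = evalf ?d c y + t * (evalf ?d c' y - evalf ?d c y)"
      by (rule rev_bexI) (simp add: evalf_def sum_distrib_left sum.distrib sum_subtractf algebra_simps)
  qed (intro continuous_on_evalf continuous_on_id continuous_on_const T | assumption)+
  have "\<exists>y\<in>UNIV. evalf ?d c y > 0" if "c \<in> K" for c using pos[OF that] by simp
  from mm[OF this] obtain F w where Fw: "finite F" "\<forall>y\<in>F. w y \<ge> 0"
      "\<forall>c\<in>K. (\<Sum>y\<in>F. w y * evalf ?d c y) > 0"
    by blast
  note F = Fw(1) Fw(2)[rule_format] Fw(3)[rule_format]
  show ?thesis
  proof (cases "k = 1")
    case True
    \<comment> \<open>A factor \<open>sqrt (w f)\<close> in the argument of a quadratic form becomes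
      the weight \<open>w f\<close>.\<close>
    obtain F' :: "(real ^ 'v) set" and y where F': "finite F'" "card F' \<le> CARD('v)"
        "\<forall>Q\<in>forms 2. (\<Sum>f\<in>F'. Q (y f)) = (\<Sum>f\<in>F. Q (sqrt (w f) *\<^sub>R f))"
      using quadratic_reduce[OF F(1), of "\<lambda>f. sqrt (w f) *\<^sub>R f"] by blast
    have "(\<Sum>f\<in>F'. 1 * evalf ?d c (y f)) > 0" if "c \<in> K" for c
    proof -
      have "(\<Sum>f\<in>F'. evalf ?d c (y f)) = (\<Sum>f\<in>F. evalf ?d c (sqrt (w f) *\<^sub>R f))"
        using True by (intro bspec[OF F'(3)]) simp
      also have "\<dots> = (\<Sum>f\<in>F. w f * evalf ?d c f)"
        using True F(2) by (intro sum.cong) (simp_all add: evalf_scaleR)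
      finally show ?thesis using F(3)[OF that] by simp
    qed
    moreover have "card F' + CARD('v) \<le> card (exps ?d :: ('v \<Rightarrow> nat) set)"
    proof -
      define N where "N = CARD('v)"
      have N: "N \<ge> 3" using v kv True by (simp add: N_def)
      have "card (exps ?d :: ('v \<Rightarrow> nat) set) = (N + 1) choose 2"
        using True by (simp add: card_exps N_def numeral_2_eq_2)
      also have "\<dots> = (N + 1) * N div 2" by (simp add: choose_two)
      \<comment> \<open>For \<open>N \<ge> 3\<close> the dimension is at least \<open>2 * N\<close>,
        which leaves room for \<open>N\<close> points.\<close>
      also have "\<dots> \<ge> (4 * N) div 2" using N by (intro div_le_mono mult_right_mono) auto
      finally show ?thesis using F'(2) by (simp add: N_def)
    qed
    ultimately show ?thesis using F'(1) by (intro exI[of _ F'] exI[of _ "\<lambda>_. 1"] exI[of _ y]) simp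
  next
    case False
    obtain i :: 'v where True by simp
    define x0 :: "real ^ 'v" where "x0 = axis i 1"
    have x0: "x0 \<noteq> 0" by (simp add: x0_def)
    obtain p where p: "p \<in> forms ?d" "\<And>y. p y \<ge> 0" "p x0 \<noteq> 0"
        "\<And>c. c \<in> K \<Longrightarrow> \<exists>y\<in>insert x0 {z. p z = 0}. evalf ?d c y > 0"
      using extremal_nonneg_form[OF k x0 F(3) nonneg] by blast
    obtain F1 w1 where Fw1: "finite F1" "F1 \<subseteq> insert x0 {z. p z = 0}" "\<forall>y\<in>F1. w1 y \<ge> 0"
        "\<forall>c\<in>K. (\<Sum>y\<in>F1. w1 y * evalf ?d c y) > 0"
      using mm[OF p(4)] by blast
    note F1 = Fw1(1,2) Fw1(3)[rule_format] Fw1(4)[rule_format]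
    \<comment> \<open>\<open>x0\<close> is kept out of the reduction: it is not a zero of
      \<open>p\<close>, so \<open>q\<close> and \<open>r\<close> need not vanish there.\<close>
    have "finite (F1 - {x0})" "\<And>f. f \<in> F1 - {x0} \<Longrightarrow> w1 f \<ge> 0" using F1(1,3) by auto
    from conic_caratheodory[of _ w1 "exps ?d" "\<lambda>z b. mon b z", OF this]
    obtain S w2 where Sw: "S \<subseteq> F1 - {x0}" "\<forall>z\<in>S. w2 z \<ge> 0"
        "\<forall>b\<in>exps ?d. (\<Sum>z\<in>S. w2 z * mon b z) = (\<Sum>z\<in>F1 - {x0}. w1 z * mon b z)"
        "indep_vecs (exps ?d) (\<lambda>z b. mon b z) S" by blast
    note S = Sw(1) Sw(2)[rule_format] Sw(3)[rule_format] Sw(4)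
    define e where "e = ?d - 1"
    have e: "?d = Suc e" "e \<ge> 2" using k False by (auto simp: e_def)
    obtain q r where qr: "q \<in> forms e" "r \<in> forms (Suc e)" "\<exists>y. q y \<noteq> 0"
        "\<forall>l. \<exists>y. r y \<noteq> (\<Sum>j\<in>UNIV. l j * y $ j) * q y"
        "\<forall>z. p z = 0 \<longrightarrow> q z = 0 \<and> r z = 0"
      using vanishing_pair[OF p(1)[unfolded e(1)] e(2) v p(2,3)] by blast
    have finS: "finite S" using S(1) F1(1) finite_subset by blast
    from qr(3) obtain y0 where "q y0 \<noteq> 0" ..
    have "card S + CARD('v) + 1 \<le> card (exps (Suc e) :: ('v \<Rightarrow> nat) set)"
    proof (rule card_indep_zeros[OF qr(1) \<open>q y0 \<noteq> 0\<close> qr(2)])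
      show "q z = 0 \<and> r z = 0" if "z \<in> S" for z
        using that S(1) F1(2) qr(5) by blast
      show "\<exists>y. r y \<noteq> (\<Sum>j\<in>UNIV. l j * y $ j) * q y" for l
        using qr(4) by blast
    qed (use finS S(4) e(1) in simp_all)
    moreover have x0S: "x0 \<notin> S" using S(1) by blast
    ultimately have card: "card (insert x0 S) + CARD('v) \<le> card (exps ?d :: ('v \<Rightarrow> nat) set)"
      using finS by (simp add: e(1))
    \<comment> \<open>If \<open>x0\<close> does not occur in \<open>F1\<close>, it enters with
      weight zero.\<close>
    define w3 where "w3 z = (if z = x0 then if x0 \<in> F1 then w1 x0 else 0 else w2 z)" for z
    have "(\<Sum>z\<in>insert x0 S. w3 z * evalf ?d c z) > 0" if c: "c \<in> K" for c
    proof -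
      have sw: "(\<Sum>z\<in>X. u z * evalf ?d c z) = (\<Sum>b\<in>exps ?d. c b * (\<Sum>z\<in>X. u z * mon b z))"
        for X :: "(real ^ 'v) set" and u
        unfolding evalf_def sum_distrib_left by (subst sum.swap) (simp add: mult_ac)
      have "(\<Sum>z\<in>S. w3 z * evalf ?d c z) = (\<Sum>z\<in>S. w2 z * evalf ?d c z)"
        by (rule sum.cong) (use x0S in \<open>auto simp: w3_def\<close>)
      also have "\<dots> = (\<Sum>z\<in>F1 - {x0}. w1 z * evalf ?d c z)"
        unfolding sw using S(3) by (intro sum.cong) auto
      finally have "(\<Sum>z\<in>insert x0 S. w3 z * evalf ?d c z)
          = w3 x0 * evalf ?d c x0 + (\<Sum>z\<in>F1 - {x0}. w1 z * evalf ?d c z)"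
        using finS x0S by simp
      also have "\<dots> = (\<Sum>z\<in>F1. w1 z * evalf ?d c z)"
        using F1(1) by (cases "x0 \<in> F1") (simp_all add: w3_def sum.remove)
      finally show ?thesis using F1(4)[OF c] by simp
    qed
    moreover have "\<forall>z\<in>insert x0 S. w3 z \<ge> 0" using F1(3) S(2) by (auto simp: w3_def)
    ultimately show ?thesis using card finS
      by (intro exI[of _ "insert x0 S"] exI[of _ w3] exI[of _ "\<lambda>z. z"]) blast
  qed
qed

section \<open>Superlevel sets of large measure\<close>

text \<open>\<open>None\<close> is the homogenising coordinate; its vanishing describes the points
  at infinity.\<close>

definition homog :: "real ^ 'n::finite \<Rightarrow> real ^ 'n option" where
  "homog x = (\<chi> i. case i of None \<Rightarrow> 1 | Some j \<Rightarrow> x $ j)"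

lemma homog_nth [simp]: "homog x $ None = 1" "homog x $ Some j = x $ j"
  by (simp_all add: homog_def)

lemma homog_line: "homog (x0 + t *\<^sub>R (x - x0)) = homog x0 + t *\<^sub>R (homog x - homog x0)"
proof -
  have "homog (x0 + t *\<^sub>R (x - x0)) $ i = (homog x0 + t *\<^sub>R (homog x - homog x0)) $ i" for i
    by (cases i) simp_all
  thus ?thesis by (simp add: vec_eq_iff)
qed

lemma dehomog:
  fixes y :: "real ^ 'n::finite option"
  assumes "y $ None \<noteq> 0"
  shows "y = y $ None *\<^sub>R homog (\<chi> j. y $ Some j / y $ None)"
  unfolding vec_eq_iff
proof
  fix i
  show "y $ i = (y $ None *\<^sub>R homog (\<chi> j. y $ Some j / y $ None)) $ i"
    using assms by (cases i) simp_all
qed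

lemma continuous_on_homog [continuous_intros]:
  assumes "continuous_on S f"
  shows "continuous_on S (\<lambda>x. homog (f x))"
proof -
  have "continuous_on S (\<lambda>x. case i of None \<Rightarrow> 1 | Some j \<Rightarrow> f x $ j)" for i
    by (cases i) (simp_all add: continuous_on_component assms)
  thus ?thesis unfolding homog_def by (intro continuous_on_vec_lambda)
qed

text \<open>Moving \<open>y0\<close> in the direction of \<open>None\<close> meets only finitely
  many zeros of \<open>F\<close>, so some point off infinity has a nonzero value, and scaling brings
  it to the form \<open>homog x\<close>.\<close>

lemma forms_homog_nonzero:
  fixes F :: "real ^ 'n::finite option \<Rightarrow> real"
  assumes F: "F \<in> forms d" and "F y0 \<noteq> 0"
  obtains x where "F (homog x) \<noteq> 0"
proof -
  let ?e = "axis None 1 :: real ^ 'n option"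
  have "finite ({t. F (y0 + t *\<^sub>R ?e) = 0} \<union> {- (y0 $ None)})"
    using assms by (auto intro!: finite_zeros_forms_line[OF F, of _ 0])
  then obtain t where t: "t \<notin> {t. F (y0 + t *\<^sub>R ?e) = 0} \<union> {- (y0 $ None)}"
    using infinite_UNIV_char_0[where 'a = real] by (metis ex_new_if_finite)
  define y where "y = y0 + t *\<^sub>R ?e"
  have y: "y $ None \<noteq> 0" "F y \<noteq> 0" using t by (auto simp: y_def axis_def)
  have "F y = (y $ None) ^ d * F (homog (\<chi> j. y $ Some j / y $ None))"
    using forms_scaleR[OF F] dehomog[OF y(1)] by metis
  with y(2) that show thesis by auto
qed

text \<open>Along every ray from a point \<open>x\<^sub>0\<close> off the zero set there are only finitely many zeros, so by
  Fubini almost every homothetic image of the zero set with centre \<open>x\<^sub>0\<close> is a null set.\<close>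

lemma AE_forms_nonzero:
  fixes F :: "real ^ 'n::finite option \<Rightarrow> real"
  assumes F: "F \<in> forms d" and "F y0 \<noteq> 0"
  shows "AE x in lborel. F (homog x) \<noteq> 0"
proof -
  obtain x0 where x0: "F (homog x0) \<noteq> 0" using forms_homog_nonzero[OF assms] .
  define T where "T t x = x0 + t *\<^sub>R (x - x0)" for t and x :: "real ^ 'n"
  have cF: "continuous_on S (\<lambda>z. F (homog (h z)))" if "continuous_on S h"
    for S :: "'z::topological_space set" and h
    by (rule continuous_on_compose2[OF forms_continuous[OF F, of UNIV] continuous_on_homog[OF that]]) simp
  have fin: "AE t in lborel. F (homog (T t x)) \<noteq> 0" for x
  proof -
    have "finite {t. F (homog (T t x)) = 0}"
      unfolding T_def homog_line using x0 by (intro finite_zeros_forms_line[OF F, of _ 0]) simp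
    hence "{t. F (homog (T t x)) = 0} \<in> null_sets lborel"
      by (rule finite_imp_null_set_lborel)
    thus ?thesis by (rule AE_I') auto
  qed
  have "AE x in lborel. AE t in lborel. F (homog (T t x)) \<noteq> 0" using fin by simp
  moreover have "{z \<in> space (lborel \<Otimes>\<^sub>M lborel). F (homog (T (snd z) (fst z))) \<noteq> 0}
      \<in> sets (lborel \<Otimes>\<^sub>M (lborel :: real measure))"
  proof -
    have "open {z. F (homog (T (snd z) (fst z))) \<noteq> 0}"
      unfolding T_def by (intro open_Collect_neq cF continuous_intros)
    thus ?thesis unfolding lborel_prod by simp
  qed
  \<comment> \<open>Fubini's theorem exchanges the order of the two quantifiers.\<close>
  ultimately have "AE t in lborel. AE x in lborel. F (homog (T t x)) \<noteq> 0"
    by (subst lborel_pair.AE_commute[symmetric]) auto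
  hence ae: "AE t in lborel. t \<noteq> 0 \<and> (AE x in lborel. F (homog (T t x)) \<noteq> 0)"
    using AE_lborel_singleton[of "0::real"] by eventually_elim simp
  have "ae_filter (lborel :: real measure) \<noteq> bot"
    by (simp add: ae_filter_eq_bot_iff)
  from eventually_happens'[OF this ae]
  obtain t where t: "t \<noteq> 0" "AE x in lborel. F (homog (T t x)) \<noteq> 0" by blast
  \<comment> \<open>For \<open>t \<noteq> 0\<close> the map \<open>T t\<close> is affine and
    invertible and scales Lebesgue measure by a constant, so the statement can be carried back along
    it.\<close>
  have Teq: "T t = (\<lambda>x. (x0 - t *\<^sub>R x0) + t *\<^sub>R x)"
    by (auto simp: T_def algebra_simps)
  have op: "open {x. F (homog x) \<noteq> 0}" by (intro open_Collect_neq cF continuous_intros)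
  have "AE x in distr lborel borel (T t). F (homog x) \<noteq> 0"
    using t(2) op by (subst AE_distr_iff) (auto simp: Teq)
  hence "AE x in density (distr lborel borel (T t)) (\<lambda>_. ennreal (\<bar>t\<bar> ^ DIM(real ^ 'n))). F (homog x) \<noteq> 0"
    by (subst AE_density) auto
  thus ?thesis unfolding Teq lborel_affine[OF t(1), of "x0 - t *\<^sub>R x0", symmetric]
    by (simp add: lborel_affine[OF t(1), of "x0 - t *\<^sub>R x0", symmetric])
qed

text \<open>The inequality is not strict, so that the set comes out closed.\<close>

definition deep_coeffs ::
    "(real ^ 'n::finite) measure \<Rightarrow> nat \<Rightarrow> real \<Rightarrow> (('n option \<Rightarrow> nat) \<Rightarrow> real) set" where
  "deep_coeffs \<mu> d t = {c \<in> unit_coeffs d. t \<le> measure \<mu> {x. 0 \<le> evalf d c (homog x)}}"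

lemma unit_coeffs_nonzero:
  assumes "c \<in> unit_coeffs d"
  obtains y where "evalf d c y \<noteq> 0"
proof -
  have "\<not> (\<forall>y. evalf d c y = 0)"
  proof
    assume "\<forall>y. evalf d c y = 0"
    hence "\<forall>b\<in>exps d. c b = 0" by (auto intro: evalf_eq_0D)
    thus False using assms by (simp add: unit_coeffs_def)
  qed
  thus thesis using that by blast
qed

lemma continuous_on_evalf_homog: "continuous_on S (\<lambda>x. evalf d c (homog x))"
  by (intro continuous_on_evalf continuous_on_const continuous_on_homog continuous_on_id)

section \<open>Absolutely continuous probability measures\<close>

locale ac_prob_space = prob_space \<mu> for \<mu> :: "(real ^ 'n::finite) measure" +
  assumes sets_borel: "sets \<mu> = sets borel"
    and ac: "absolutely_continuous lborel \<mu>"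
begin

lemma space_eq [simp]: "space \<mu> = UNIV"
  using sets_eq_imp_space_eq[OF sets_borel] by simp

lemma AE_unit_coeffs_nonzero:
  assumes "c \<in> unit_coeffs d"
  shows "AE x in \<mu>. evalf d c (homog x) \<noteq> 0"
proof -
  obtain y where y: "evalf d c y \<noteq> 0" using unit_coeffs_nonzero[OF assms] .
  have "AE x in lborel. evalf d c (homog x) \<noteq> 0"
    by (rule AE_forms_nonzero[OF evalf_in_forms y])
  moreover have "closed {x :: real ^ 'n. evalf d c (homog x) = 0}"
    by (intro closed_Collect_eq continuous_on_evalf_homog continuous_on_const)
  ultimately have "{x :: real ^ 'n. evalf d c (homog x) = 0} \<in> null_sets lborel"
    by (subst (asm) AE_iff_null) (auto simp: Compl_eq[symmetric])
  hence "{x :: real ^ 'n. evalf d c (homog x) = 0} \<in> null_sets \<mu>"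
    using ac by (auto simp: absolutely_continuous_def)
  thus ?thesis by (rule AE_I') auto
qed

lemma sets_evalf [simp]:
  "{x. 0 \<le> evalf d c (homog x)} \<in> sets \<mu>" "{x. evalf d c (homog x) \<le> 0} \<in> sets \<mu>"
proof -
  note c = continuous_on_evalf_homog continuous_on_const
  have "closed {x :: real ^ 'n. 0 \<le> evalf d c (homog x)}" by (intro closed_Collect_le c)
  moreover have "closed {x :: real ^ 'n. evalf d c (homog x) \<le> 0}" by (intro closed_Collect_le c)
  ultimately show "{x. 0 \<le> evalf d c (homog x)} \<in> sets \<mu>" "{x. evalf d c (homog x) \<le> 0} \<in> sets \<mu>"
    by (auto simp: sets_borel)
qed

text \<open>Off the zero set of the limit form, which is a null set, the indicator functions of the
  superlevel sets converge; by dominated convergence the measure depends continuously on the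
  coefficients.\<close>

lemma compact_deep_coeffs: "compact (deep_coeffs \<mu> d t)"
proof -
  have "continuous_on (unit_coeffs d) (\<lambda>c. measure \<mu> {x. 0 \<le> evalf d c (homog x)})"
  proof (rule continuous_on_sequentiallyI)
    fix u :: "nat \<Rightarrow> ('n option \<Rightarrow> nat) \<Rightarrow> real" and c
    assume u: "\<forall>n. u n \<in> unit_coeffs d" and c: "c \<in> unit_coeffs d" and lim: "u \<longlonglongrightarrow> c"
    define I where "I c x = indicat_real {x. 0 \<le> evalf d c (homog x)} x" for c and x :: "real ^ 'n"
    have meas: "I c \<in> borel_measurable \<mu>" for c
      unfolding I_def[abs_def] by (intro borel_measurable_indicator sets_evalf)
    have "(\<lambda>n. integral\<^sup>L \<mu> (I (u n))) \<longlonglongrightarrow> integral\<^sup>L \<mu> (I c)"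
    proof (rule integral_dominated_convergence[where w = "\<lambda>_. 1"])
      show "AE x in \<mu>. (\<lambda>n. I (u n) x) \<longlonglongrightarrow> I c x"
        using AE_unit_coeffs_nonzero[OF c]
      proof eventually_elim
        case (elim x)
        have "continuous_on UNIV (\<lambda>c. evalf d c (homog x))"
          by (intro continuous_on_evalf continuous_on_id continuous_on_const)
        from continuous_on_tendsto_compose[OF this lim]
        have ev: "(\<lambda>n. evalf d (u n) (homog x)) \<longlonglongrightarrow> evalf d c (homog x)" by simp
        have "\<forall>\<^sub>F n in sequentially. I (u n) x = I c x"
        proof (cases "evalf d c (homog x) > 0")
          case True
          from order_tendstoD(1)[OF ev this] show ?thesis
            by eventually_elim (use True in \<open>simp add: I_def\<close>)
        next
          case False
          hence "evalf d c (homog x) < 0" using elim by simp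
          from order_tendstoD(2)[OF ev this] show ?thesis
            by eventually_elim (use \<open>evalf d c (homog x) < 0\<close> in \<open>simp add: I_def\<close>)
        qed
        thus ?case by (rule tendsto_eventually)
      qed
    qed (simp_all add: meas, simp add: I_def)
    thus "(\<lambda>n. measure \<mu> {x. 0 \<le> evalf d (u n) (homog x)}) \<longlonglongrightarrow> measure \<mu> {x. 0 \<le> evalf d c (homog x)}"
      by (simp add: I_def[abs_def])
  qed
  moreover have "closed (unit_coeffs d :: (('n option \<Rightarrow> nat) \<Rightarrow> real) set)"
    by (rule compact_imp_closed[OF compact_unit_coeffs])
  ultimately have "closed (deep_coeffs \<mu> d t)"
    unfolding deep_coeffs_def by (intro continuous_on_closed_Collect_le continuous_on_const)
  hence "compact (unit_coeffs d \<inter> deep_coeffs \<mu> d t)"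
    by (intro compact_Int_closed compact_unit_coeffs)
  thus ?thesis by (simp add: deep_coeffs_def Int_absorb1)
qed

lemma nonneg_in_deep_coeffs:
  assumes "c \<in> unit_coeffs d" "\<And>y. evalf d c y \<ge> 0" "t \<le> 1"
  shows "c \<in> deep_coeffs \<mu> d t"
  using assms prob_space by (simp add: deep_coeffs_def)

text \<open>Zeros being negligible, each form is nonpositive on a set of measure at most
  \<open>1 - t\<close>, and \<open>N\<close> such sets do not cover the space.\<close>

lemma common_positive_point:
  fixes P :: "nat \<Rightarrow> ('n option \<Rightarrow> nat) \<Rightarrow> real"
  assumes P: "\<And>i. i < N \<Longrightarrow> P i \<in> deep_coeffs \<mu> d t" and t: "real N * (1 - t) < 1"
  obtains x where "\<And>i. i < N \<Longrightarrow> evalf d (P i) (homog x) > 0"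
proof -
  define B where "B i = {x. evalf d (P i) (homog x) \<le> 0}" for i
  have B: "measure \<mu> (B i) \<le> 1 - t" if i: "i < N" for i
  proof -
    have "measure \<mu> (B i) = measure \<mu> (- {x. 0 \<le> evalf d (P i) (homog x)})"
    proof (rule finite_measure_eq_AE)
      show "AE x in \<mu>. (x \<in> B i) = (x \<in> - {x. 0 \<le> evalf d (P i) (homog x)})"
        using AE_unit_coeffs_nonzero[of "P i" d] P[OF i]
        by (auto simp: deep_coeffs_def B_def elim: eventually_mono)
    qed (auto simp: B_def intro: sets.compl_sets[of _ \<mu>, simplified Compl_eq_Diff_UNIV[symmetric] space_eq])
    also have "\<dots> = 1 - measure \<mu> {x. 0 \<le> evalf d (P i) (homog x)}"
      using prob_compl[of "{x. 0 \<le> evalf d (P i) (homog x)}"] by (simp add: Compl_eq_Diff_UNIV)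
    also have "\<dots> \<le> 1 - t" using P[OF i] by (simp add: deep_coeffs_def)
    finally show ?thesis .
  qed
  have "measure \<mu> (\<Union>i<N. B i) \<le> (\<Sum>i<N. measure \<mu> (B i))"
    by (intro finite_measure_subadditive_finite) (auto simp: B_def)
  also have "\<dots> \<le> (\<Sum>i<N. 1 - t)" by (intro sum_mono B) simp
  also have "\<dots> < 1" using t by simp
  finally have "(\<Union>i<N. B i) \<noteq> UNIV" using prob_space by auto
  then obtain x where "x \<notin> (\<Union>i<N. B i)" by blast
  thus thesis using that[of x] by (force simp: B_def not_le)
qed

end

section \<open>Convex hulls and points at infinity\<close>

text \<open>By Caratheodory's theorem this is the convex hull of \<open>G\<close> once \<open>n\<close> exceeds the number of
  relevant coordinates; the parametrisation by a product makes it compact.\<close>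

definition combos :: "nat \<Rightarrow> ('i \<Rightarrow> real) set \<Rightarrow> ('i \<Rightarrow> real) set" where
  "combos n G = (\<lambda>(l, P) b. \<Sum>i<n. l i * P i b) `
    ({l \<in> Pi UNIV (\<lambda>_. {0..1}). (\<Sum>i<n. l i) = 1} \<times> Pi UNIV (\<lambda>_. G))"

lemma combosE:
  assumes "c \<in> combos n G"
  obtains l P where "c = (\<lambda>b. \<Sum>i<n. l i * P i b)" "\<And>i. l i \<ge> 0" "(\<Sum>i<n. l i) = 1"
    "\<And>i. P i \<in> G"
proof -
  obtain l P where "c = (\<lambda>b. \<Sum>i<n. l i * P i b)" "l \<in> Pi UNIV (\<lambda>_. {0..1})" "(\<Sum>i<n. l i) = 1"
    "P \<in> Pi UNIV (\<lambda>_. G)"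
    using assms unfolding combos_def by auto
  thus thesis by (intro that[of l P]) auto
qed

lemma compact_combos:
  assumes "compact G"
  shows "compact (combos n G)"
  unfolding combos_def
proof (rule compact_continuous_image)
  let ?L = "{l :: nat \<Rightarrow> real. l \<in> Pi UNIV (\<lambda>_. {0..1}) \<and> (\<Sum>i<n. l i) = 1}"
  have "closed {l :: nat \<Rightarrow> real. (\<Sum>i<n. l i) = 1}"
    by (intro closed_Collect_eq continuous_on_sum continuous_on_product_coordinates continuous_on_const)
  hence "compact (Pi UNIV (\<lambda>_ :: nat. {0..1 :: real}) \<inter> {l. (\<Sum>i<n. l i) = 1})"
    by (intro compact_Int_closed compact_Pi_UNIV) simp_all
  hence "compact ?L" by (simp add: Int_def)
  thus "compact (?L \<times> Pi UNIV (\<lambda>_. G))"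
    by (intro compact_Times compact_Pi_UNIV assms)
next
  let ?S = "{l :: nat \<Rightarrow> real. l \<in> Pi UNIV (\<lambda>_. {0..1}) \<and> (\<Sum>i<n. l i) = 1} \<times> Pi UNIV (\<lambda>_ :: nat. G)"
  have 1: "continuous_on ?S (\<lambda>z. fst z i)" for i
    by (rule continuous_on_product_then_coordinatewise[OF continuous_on_fst[OF continuous_on_id]])
  have 2: "continuous_on ?S (\<lambda>z. snd z i b)" for i b
    by (rule continuous_on_product_then_coordinatewise[OF
        continuous_on_product_then_coordinatewise[OF continuous_on_snd[OF continuous_on_id]]])
  have "continuous_on ?S (\<lambda>z b. \<Sum>i<n. fst z i * snd z i b)"
    by (rule continuous_on_coordinatewise_then_product) (intro continuous_on_sum continuous_on_mult 1 2)
  thus "continuous_on ?S (\<lambda>(l, P) b. \<Sum>i<n. l i * P i b)" by (simp add: case_prod_unfold)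
qed

text \<open>The additional coordinate \<open>None\<close>, constantly 1, records the sum of the
  weights, so that a conic reduction in \<open>card I + 1\<close> dimensions keeps the combination
  convex.\<close>

lemma combos_caratheodory:
  fixes P :: "'f \<Rightarrow> 'i \<Rightarrow> real"
  assumes I: "finite I" and G: "\<forall>g\<in>G. \<forall>b. b \<notin> I \<longrightarrow> g b = 0"
    and F: "finite F" "\<And>f. f \<in> F \<Longrightarrow> w f \<ge> 0" "(\<Sum>f\<in>F. w f) = 1" "\<And>f. f \<in> F \<Longrightarrow> P f \<in> G"
  shows "(\<lambda>b. \<Sum>f\<in>F. w f * P f b) \<in> combos (card I + 1) G"
proof -
  let ?I = "insert None (Some ` I)"
  define u where "u f i = (case i of None \<Rightarrow> 1 | Some b \<Rightarrow> P f b)" for f i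
  from conic_caratheodory[of F w ?I u, OF F(1,2)]
  obtain F' w' where F': "F' \<subseteq> F" "\<forall>f\<in>F'. w' f \<ge> 0"
      "\<forall>i\<in>?I. (\<Sum>f\<in>F'. w' f * u f i) = (\<Sum>f\<in>F. w f * u f i)" "indep_vecs ?I u F'"
    by blast
  have finF': "finite F'" using F'(1) F(1) finite_subset by blast
  have "card F' \<le> card ?I"
    using not_indep_vecs_if_card[of ?I F' u] F'(4) finF' I by force
  also have "\<dots> = card I + 1"
    using I by (subst card_insert_disjoint) (auto simp: card_image)
  finally have card: "card F' \<le> card I + 1" .
  have sum1: "(\<Sum>f\<in>F'. w' f) = 1"
    using bspec[OF F'(3), of None] F(3) by (simp add: u_def)
  have eq: "(\<Sum>f\<in>F'. w' f * P f b) = (\<Sum>f\<in>F. w f * P f b)" for b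
  proof (cases "b \<in> I")
    case True
    thus ?thesis using bspec[OF F'(3), of "Some b"] by (simp add: u_def)
  next
    case False
    hence "P f b = 0" if "f \<in> F" for f using G F(4) that by blast
    thus ?thesis using F'(1) by (simp add: subset_iff)
  qed
  obtain h where h: "bij_betw h {..<card F'} F'"
    using ex_bij_betw_nat_finite[OF finF'] by (auto simp: atLeast0LessThan)
  obtain f0 where f0: "f0 \<in> F'" using sum1 by fastforce
  \<comment> \<open>Places beyond \<open>card F'\<close> get weight zero and the filler
    \<open>P f0\<close>, as every component has to lie in \<open>G\<close>.\<close>
  define l where "l i = (if i < card F' then w' (h i) else 0)" for i
  define Q where "Q i = (if i < card F' then P (h i) else P f0)" for i
  have hF': "h i \<in> F'" if "i < card F'" for i using h that by (auto simp: bij_betw_def)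
  have sums: "(\<Sum>i<card I + 1. l i * g (Q i)) = (\<Sum>f\<in>F'. w' f * g (P f))" for g
  proof -
    have "(\<Sum>i<card I + 1. l i * g (Q i)) = (\<Sum>i<card F'. l i * g (Q i))"
      by (rule sum.mono_neutral_right) (use card in \<open>auto simp: l_def\<close>)
    also have "\<dots> = (\<Sum>i<card F'. w' (h i) * g (P (h i)))"
      by (intro sum.cong) (auto simp: l_def Q_def)
    also have "\<dots> = (\<Sum>f\<in>F'. w' f * g (P f))" by (rule sum.reindex_bij_betw[OF h])
    finally show ?thesis .
  qed
  have l1: "(\<Sum>i<card I + 1. l i) = 1" using sums[of "\<lambda>_. 1"] sum1 by simp
  have l0: "l i \<ge> 0" for i using F'(2) hF' by (simp add: l_def)
  have "w' f \<le> 1" if "f \<in> F'" for f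
    unfolding sum1[symmetric] using that F'(2) finF' by (intro member_le_sum) auto
  hence "l \<in> Pi UNIV (\<lambda>_. {0..1})" using l0 hF' by (auto simp: l_def)
  moreover have "Q \<in> Pi UNIV (\<lambda>_. G)" using F(4) F'(1) f0 hF' by (auto simp: Q_def subset_iff)
  moreover have "(\<lambda>b. \<Sum>f\<in>F. w f * P f b) = (\<lambda>(l, P) b. \<Sum>i<card I + 1. l i * P i b) (l, Q)"
    using sums[of "\<lambda>p. p b" for b] by (simp add: eq)
  ultimately show ?thesis unfolding combos_def using l1 by (intro image_eqI[of _ _ "(l, Q)"]) auto
qed

lemma combos_superset:
  assumes "finite I" "\<forall>g\<in>G. \<forall>b. b \<notin> I \<longrightarrow> g b = 0" "c \<in> G"
  shows "c \<in> combos (card I + 1) G"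
proof -
  have "(\<lambda>b. \<Sum>f\<in>{()}. 1 * c b) \<in> combos (card I + 1) G"
    by (rule combos_caratheodory[of I G "{()}" "\<lambda>_. 1" "\<lambda>_. c"]) (use assms in auto)
  thus ?thesis by simp
qed

text \<open>The two combinations are merged over a disjoint union and cut down again by
  \<open>combos_caratheodory\<close>.\<close>

lemma combos_convex:
  assumes I: "finite I" and G: "\<forall>g\<in>G. \<forall>b. b \<notin> I \<longrightarrow> g b = 0"
    and c: "c \<in> combos (card I + 1) G" "c' \<in> combos (card I + 1) G" and t: "0 \<le> t" "t \<le> (1::real)"
  shows "(\<lambda>b. c b + t * (c' b - c b)) \<in> combos (card I + 1) G"
proof -
  let ?n = "card I + 1"
  obtain l P where c1: "c = (\<lambda>b. \<Sum>i<?n. l i * P i b)" "\<And>i. l i \<ge> 0" "(\<Sum>i<?n. l i) = 1" "\<And>i. P i \<in> G"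
    using c(1) by (rule combosE) blast
  obtain l' P' where c2: "c' = (\<lambda>b. \<Sum>i<?n. l' i * P' i b)" "\<And>i. l' i \<ge> 0" "(\<Sum>i<?n. l' i) = 1" "\<And>i. P' i \<in> G"
    using c(2) by (rule combosE) blast
  define w where "w = case_sum (\<lambda>i. (1 - t) * l i) (\<lambda>i. t * l' i)"
  define R where "R = case_sum P P'"
  have "(\<lambda>b. \<Sum>f\<in>{..<?n} <+> {..<?n}. w f * R f b) \<in> combos ?n G"
  proof (rule combos_caratheodory[OF I G])
    show "(\<Sum>f\<in>{..<?n} <+> {..<?n}. w f) = 1"
      by (simp only: sum.Plus finite_lessThan w_def comp_def sum.case)
        (simp only: sum_distrib_left[symmetric] c1(3) c2(3), simp)
  qed (use c1(2,4) c2(2,4) t in \<open>auto simp: w_def R_def\<close>)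
  moreover have "(\<Sum>f\<in>{..<?n} <+> {..<?n}. w f * R f b) = c b + t * (c' b - c b)" for b
  proof -
    have "(\<Sum>f\<in>{..<?n} <+> {..<?n}. w f * R f b) = (1 - t) * (\<Sum>i<?n. l i * P i b) + t * (\<Sum>i<?n. l' i * P' i b)"
      by (simp only: sum.Plus finite_lessThan w_def R_def comp_def sum.case sum_distrib_left mult.assoc)
    thus ?thesis by (simp only: c1(1) c2(1)) (simp add: algebra_simps)
  qed
  ultimately show ?thesis by simp
qed

text \<open>All points are shifted by the same small \<open>e\<close> in the direction of
  \<open>None\<close>. The shifts in the unit interval for which positivity fails somewhere on
  \<open>G\<close> form a compact set that does not contain 0.\<close>

lemma move_off_infinity:
  fixes y :: "'f \<Rightarrow> real ^ 'n::finite option" and G :: "(('n option \<Rightarrow> nat) \<Rightarrow> real) set"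
  assumes G: "compact G" and F: "finite F"
    and pos: "\<And>c. c \<in> G \<Longrightarrow> (\<Sum>f\<in>F. w f * evalf d c (y f)) > 0"
  obtains y' where "\<And>f. f \<in> F \<Longrightarrow> y' f $ None \<noteq> 0"
    "\<And>c. c \<in> G \<Longrightarrow> (\<Sum>f\<in>F. w f * evalf d c (y' f)) > 0"
proof -
  define z where "z e f = y f + e *\<^sub>R axis None 1" for e f
  define B where "B = {u \<in> {0..1} \<times> G. (\<Sum>f\<in>F. w f * evalf d (snd u) (z (fst u) f)) \<le> 0}"
  have "continuous_on S (\<lambda>u :: real \<times> _. \<Sum>f\<in>F. w f * evalf d (snd u) (z (fst u) f))" for S
    unfolding z_def
    by (intro continuous_on_sum continuous_on_mult continuous_on_const continuous_on_evalf
        continuous_on_snd continuous_on_fst continuous_on_id continuous_on_add continuous_on_scaleR)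
  moreover have "compact ({0..1 :: real} \<times> G)" by (intro compact_Times G compact_Icc)
  moreover have "B = ({0..1} \<times> G) \<inter> {u. (\<Sum>f\<in>F. w f * evalf d (snd u) (z (fst u) f)) \<le> 0}"
    by (auto simp: B_def)
  ultimately have "compact B"
    by (simp only:) (intro compact_Int_closed closed_Collect_le continuous_on_const)
  hence "compact (fst ` B)" by (intro compact_continuous_image continuous_on_fst continuous_on_id)
  hence op: "open (- (fst ` B))" using compact_imp_closed by blast
  have "0 \<in> - (fst ` B)"
    using pos by (force simp: B_def z_def)
  then obtain r where r: "r > 0" "ball 0 r \<subseteq> - (fst ` B)" using op open_contains_ball by blast
  \<comment> \<open>Only finitely many shifts leave one of the points at infinity.\<close>
  have "infinite {0<..<min r 1}" using r(1) by simp
  moreover have "finite ((\<lambda>f. - (y f $ None)) ` F)" using F by simp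
  ultimately obtain e where e: "e \<in> {0<..<min r 1}" "e \<notin> (\<lambda>f. - (y f $ None)) ` F"
    by (meson finite_subset subsetI)
  have "e \<in> ball 0 r" using e(1) by auto
  hence eB: "e \<notin> fst ` B" using r(2) by blast
  show thesis
  proof (rule that[of "z e"])
    show "z e f $ None \<noteq> 0" if "f \<in> F" for f
      using e(2) that by (auto simp: z_def axis_def eq_neg_iff_add_eq_0 add.commute)
    show "(\<Sum>f\<in>F. w f * evalf d c (z e f)) > 0" if "c \<in> G" for c
    proof (rule ccontr)
      assume "\<not> ?thesis"
      hence "(e, c) \<in> B" using that e(1) by (simp add: B_def)
      thus False using eB by force
    qed
  qed
qed

section \<open>From polynomials to forms, and the theorem\<close>

lemma poly_space_homog:
  fixes P :: "real ^ 'n::finite \<Rightarrow> real"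
  assumes P: "P \<in> poly_space D" and D: "D \<le> d"
  obtains c where "\<And>x. P x = evalf d c (homog x)"
proof -
  obtain c0 where c0: "P = (\<lambda>x. \<Sum>a | (\<Sum>i\<in>UNIV. a i) \<le> D. c0 a * (\<Prod>i\<in>UNIV. (x $ i) ^ a i))"
    using P by (auto simp: poly_space_def)
  define A where "A D = {a :: 'n \<Rightarrow> nat. (\<Sum>i\<in>UNIV. a i) \<le> D}" for D
  define c where "c b = (if b \<circ> Some \<in> A D then c0 (b \<circ> Some) else 0)" for b :: "'n option \<Rightarrow> nat"
  \<comment> \<open>The homogenising coordinate takes up the degree missing to
    \<open>d\<close>.\<close>
  define ext where "ext a = (\<lambda>i. case i of None \<Rightarrow> d - (\<Sum>i\<in>UNIV. a i) | Some j \<Rightarrow> a j)" for a :: "'n \<Rightarrow> nat"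
  have split: "(\<Sum>i\<in>UNIV. b i) = b None + (\<Sum>j\<in>UNIV. b (Some j))" for b :: "'n option \<Rightarrow> nat"
    by (simp add: UNIV_option_conv sum.reindex)
  have "P x = evalf d c (homog x)" for x
  proof -
    have "mon b (homog x) = (\<Prod>j\<in>UNIV. (x $ j) ^ b (Some j))" for b
      by (simp add: mon_def UNIV_option_conv prod.reindex)
    hence "evalf d c (homog x) = (\<Sum>b\<in>exps d. c b * (\<Prod>j\<in>UNIV. (x $ j) ^ (b \<circ> Some) j))"
      by (simp add: evalf_def)
    also have "\<dots> = (\<Sum>a\<in>A d. (if a \<in> A D then c0 a else 0) * (\<Prod>j\<in>UNIV. (x $ j) ^ a j))"
    proof (rule sum.reindex_bij_witness[of _ ext "\<lambda>b. b \<circ> Some"])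
      show "ext (b \<circ> Some) = b" if "b \<in> exps d" for b
      proof
        fix i show "ext (b \<circ> Some) i = b i"
          using that split[of b] by (cases i) (auto simp: ext_def exps_def)
      qed
      show "b \<circ> Some \<in> A d" if "b \<in> exps d" for b
        using that split[of b] by (simp add: A_def exps_def)
      show "ext a \<circ> Some = a" for a by (auto simp: ext_def)
      show "ext a \<in> exps d" if "a \<in> A d" for a
        using that split[of "ext a"] by (simp add: A_def exps_def ext_def)
    qed (simp add: c_def)
    also have "\<dots> = (\<Sum>a\<in>A D. c0 a * (\<Prod>j\<in>UNIV. (x $ j) ^ a j))"
      by (rule sum.mono_neutral_cong_right)
        (use D finite_multi_indices[where 'n = 'n] in \<open>auto simp: A_def\<close>)
    finally show ?thesis by (simp add: c0 A_def)
  qed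
  thus thesis using that by blast
qed

text \<open>The zero polynomial cannot be normalised and holds everywhere, hence the demand that
  \<open>X\<close> be nonempty. Membership in \<open>poly_space D\<close> is passed on for the case
  \<open>D = 1\<close>, where the barycentre argument needs affine functions.\<close>

lemma weak_netI_homog:
  fixes \<mu> :: "(real ^ 'n::finite) measure"
  assumes D: "D \<le> 2 * k" and X: "X \<noteq> {}"
    and pos: "\<And>c. c \<in> deep_coeffs \<mu> (2 * k) t \<Longrightarrow> (\<lambda>x. evalf (2 * k) c (homog x)) \<in> poly_space D
      \<Longrightarrow> \<exists>x\<in>X. evalf (2 * k) c (homog x) \<ge> 0"
  shows "weak_net \<mu> (poly_plus D) t X"
  unfolding weak_net_def
proof (intro ballI impI)
  fix S assume S: "S \<in> poly_plus D" and t: "t < measure \<mu> S"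
  obtain P where P: "P \<in> poly_space D" "S = {x. P x \<ge> 0}" using S by (auto simp: poly_plus_def)
  obtain c where c: "\<And>x. P x = evalf (2 * k) c (homog x)" using poly_space_homog[OF P(1) D] by blast
  show "S \<inter> X \<noteq> {}"
  proof (cases "\<exists>x. P x \<noteq> 0")
    case True
    then obtain x0 where "evalf (2 * k) c (homog x0) \<noteq> 0" by (auto simp: c)
    then obtain s c' where c': "s > 0" "c' \<in> unit_coeffs (2 * k)"
        "\<And>y. evalf (2 * k) c y = s * evalf (2 * k) c' y"
      by (rule unit_coeffs_normalise) blast
    have sgn: "P x \<ge> 0 \<longleftrightarrow> evalf (2 * k) c' (homog x) \<ge> 0" for x
      unfolding c c'(3) using c'(1) by (simp add: zero_le_mult_iff)
    have "c' \<in> deep_coeffs \<mu> (2 * k) t"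
      using c'(2) t by (simp add: deep_coeffs_def P(2) sgn)
    moreover have "(\<lambda>x. evalf (2 * k) c' (homog x)) \<in> poly_space D"
    proof -
      obtain e where "P = (\<lambda>x. \<Sum>a | (\<Sum>i\<in>UNIV. a i) \<le> D. e a * (\<Prod>i\<in>UNIV. (x $ i) ^ a i))"
        using P(1) by (auto simp: poly_space_def)
      moreover have "(\<lambda>x. evalf (2 * k) c' (homog x)) = (\<lambda>x. P x / s)"
        using c'(1) by (simp add: c c'(3))
      ultimately have "(\<lambda>x. evalf (2 * k) c' (homog x))
          = (\<lambda>x. \<Sum>a | (\<Sum>i\<in>UNIV. a i) \<le> D. (e a / s) * (\<Prod>i\<in>UNIV. (x $ i) ^ a i))"
        by (simp add: sum_divide_distrib)
      thus ?thesis unfolding poly_space_def by (intro CollectI exI[of _ "\<lambda>a. e a / s"])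
    qed
    ultimately show ?thesis using pos[of c'] by (auto simp: P(2) sgn)
  qed (use X P(2) in auto)
qed

text \<open>For \<open>n = k = 1\<close> and \<open>D = 2\<close> the bound allows one point only,
  and for small \<open>\<delta>\<close> the level \<open>3/4 + \<delta>\<close> is below 1; there
  \<open>no_one_point_quadratic_net\<close> refutes the claim, so this case is excluded.\<close>

theorem corollary7:
  fixes \<mu> :: "(real ^ 'n) measure" and k D :: nat and \<delta> :: real
  assumes "k \<ge> 1" and "D \<ge> 1" and "D \<le> 2 * k"
    and "\<not> (CARD('n) = 1 \<and> k = 1 \<and> D = 2)"
    and "prob_space \<mu>" and "sets \<mu> = sets borel"
    and "absolutely_continuous lborel \<mu>"
    and "\<delta> > 0"
  shows "\<exists>X :: (real ^ 'n) set. finite X \<and>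
           int (card X) \<le> int ((2 * k + CARD('n)) choose CARD('n)) - int CARD('n) - 1 \<and>
           weak_net \<mu> (poly_plus D)
             (1 - 1 / (real ((CARD('n) + 2 * k) choose CARD('n)) + 1) + \<delta>) X"
proof -
  let ?d = "2 * k"
  let ?E = "exps ?d :: ('n option \<Rightarrow> nat) set"
  interpret ac_prob_space \<mu>
    using assms(5-7) by (simp add: ac_prob_space_def ac_prob_space_axioms_def)
  have cardE: "card ?E = (2 * k + CARD('n)) choose CARD('n)"
    by (simp add: card_exps card_UNIV_option binomial_symmetric[of ?d])
  define m where "m = card ?E"
  \<comment> \<open>The cap at 1 puts all normalised nonnegative forms into
    \<open>G\<close>.\<close>
  define t where "t = min 1 (1 - 1 / (real m + 1) + \<delta>)"
  define G where "G = deep_coeffs \<mu> ?d t"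
  define K where "K = combos (m + 1) G"
  have G0: "\<forall>g\<in>G. \<forall>b. b \<notin> ?E \<longrightarrow> g b = 0"
    by (simp add: G_def deep_coeffs_def unit_coeffs_def)
  have compG: "compact G" unfolding G_def by (rule compact_deep_coeffs)
  have compK: "compact K" unfolding K_def by (rule compact_combos[OF compG])
  have GK: "c \<in> K" if "c \<in> G" for c
    unfolding K_def m_def by (rule combos_superset[OF finite_exps G0 that])
  have convK: "(\<lambda>b. c b + s * (c' b - c b)) \<in> K" if "c \<in> K" "c' \<in> K" "0 \<le> s" "s \<le> 1" for c c' s
    using that unfolding K_def m_def by (intro combos_convex[OF finite_exps G0])
  have nonnegG: "c \<in> G" if "c \<in> unit_coeffs ?d" "\<And>y. evalf ?d c y \<ge> 0" for c
    unfolding G_def by (rule nonneg_in_deep_coeffs[OF that]) (simp add: t_def)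
  \<comment> \<open>Here \<open>\<delta> > 0\<close> enters: the exceptional sets of
    \<open>m + 1\<close> elements of \<open>G\<close> cannot cover the space.\<close>
  have small: "real (m + 1) * (1 - t) < 1"
  proof -
    have "1 - t < 1 / (real m + 1)" using assms(8) by (simp add: t_def min_def)
    thus ?thesis by (simp add: pos_less_divide_eq mult.commute add.commute)
  qed
  have posK: "\<exists>x. evalf ?d c (homog x) > 0" if c: "c \<in> K" for c
  proof -
    obtain l P where lP: "c = (\<lambda>b. \<Sum>i<m + 1. l i * P i b)" "\<And>i. l i \<ge> 0"
        "(\<Sum>i<m + 1. l i) = 1" "\<And>i. P i \<in> G"
      using c unfolding K_def by (rule combosE) blast
    obtain x where x: "\<And>i. i < m + 1 \<Longrightarrow> evalf ?d (P i) (homog x) > 0"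
      using common_positive_point[OF _ small, of P ?d] lP(4) by (auto simp: G_def)
    have "evalf ?d c (homog x) = (\<Sum>i<m + 1. l i * evalf ?d (P i) (homog x))"
      unfolding lP(1) evalf_def sum_distrib_left sum_distrib_right
      by (subst sum.swap) (simp add: mult_ac)
    moreover have "\<dots> > 0"
    proof -
      have "\<exists>i<m + 1. l i \<noteq> 0"
        by (rule ccontr) (use lP(3) in auto)
      then obtain i where i: "i < m + 1" "l i > 0" using lP(2) by (metis less_eq_real_def)
      show ?thesis
      proof (rule sum_pos2[of _ i])
        show "l j * evalf ?d (P j) (homog x) \<ge> 0" if "j \<in> {..<m + 1}" for j
          using that by (intro mult_nonneg_nonneg lP(2) less_imp_le[OF x]) simp
      qed (use i x[OF i(1)] in simp_all)
    qed
    ultimately have "evalf ?d c (homog x) > 0" by (simp only:)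
    thus ?thesis ..
  qed
  \<comment> \<open>\<open>G\<close> contains a normalised even power of the homogenising
    coordinate. As \<open>G\<close> is nonempty, positivity of the weighted sums on \<open>G\<close>
    excludes an empty set of points.\<close>
  have G_ne: "G \<noteq> {}"
  proof -
    have "(\<lambda>y :: real ^ 'n option. (y $ None) ^ ?d) \<in> forms ?d" by (rule coord_power_in_forms)
    then obtain c where "(\<lambda>y :: real ^ 'n option. (y $ None) ^ ?d) = evalf ?d c" by (rule formsE)
    hence c: "evalf ?d c y = (y $ None) ^ ?d" for y by (simp add: fun_eq_iff)
    have "evalf ?d c (axis None 1) \<noteq> 0" by (simp add: c axis_def)
    then obtain s c' where c': "s > 0" "c' \<in> unit_coeffs ?d" "\<And>y. evalf ?d c y = s * evalf ?d c' y"
      by (rule unit_coeffs_normalise) blast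
    have "evalf ?d c' y \<ge> 0" for y
    proof -
      have "s * evalf ?d c' y \<ge> 0" unfolding c'(3)[symmetric] c by simp
      thus ?thesis using c'(1) by (simp add: zero_le_mult_iff)
    qed
    thus ?thesis using nonnegG[OF c'(2)] by blast
  qed
  have "\<exists>X. finite X \<and> int (card X) \<le> int m - int CARD('n) - 1 \<and> weak_net \<mu> (poly_plus D) t X"
  proof (cases "k = 1 \<and> CARD('n) = 1")
    case True
    hence D: "D = 1" using assms(2-4) by auto
    have "\<exists>F w. finite F \<and> F \<subseteq> range homog \<and> (\<forall>y\<in>F. w y \<ge> 0) \<and> (\<forall>c\<in>K. (\<Sum>y\<in>F. w y * evalf ?d c y) > 0)"
    proof (rule minimax_cover[OF compK])
      fix c c' s assume "c \<in> K" "c' \<in> K" "0 \<le> s" "s \<le> (1::real)"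
      from convK[OF this] show "\<exists>c''\<in>K. \<forall>y\<in>range homog. evalf ?d c'' y = evalf ?d c y + s * (evalf ?d c' y - evalf ?d c y)"
        by (rule rev_bexI) (simp add: evalf_def sum_distrib_left sum.distrib sum_subtractf algebra_simps)
    qed (use posK in \<open>auto intro!: continuous_on_evalf continuous_on_id continuous_on_const\<close>)
    then obtain F w where F: "finite F" "F \<subseteq> range homog" "\<forall>y\<in>F. w y \<ge> 0"
        "\<forall>c\<in>K. (\<Sum>y\<in>F. w y * evalf ?d c y) > 0" by blast
    define W where "W = (\<Sum>y\<in>F. w y)"
    \<comment> \<open>For affine functions, the weighted sum of the values is \<open>W\<close> times
      the value at the barycentre, so this single point suffices.\<close>
    define Y where "Y = (\<Sum>y\<in>F. w y *\<^sub>R y)"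
    have "W \<noteq> 0"
    proof
      assume "W = 0"
      hence "\<forall>y\<in>F. w y = 0" unfolding W_def using F(1,3) by (subst (asm) sum_nonneg_eq_0_iff) auto
      thus False using F(4) G_ne GK by fastforce
    qed
    hence W: "W > 0" using F(3) by (simp add: W_def sum_nonneg less_le)
    have YW: "Y $ None = W"
      unfolding Y_def W_def sum_component using F(2) by (intro sum.cong) auto
    define x where "x = (\<chi> j. Y $ Some j / Y $ None)"
    have Yx: "Y = W *\<^sub>R homog x" using dehomog[of Y] W YW by (simp add: x_def)
    have "weak_net \<mu> (poly_plus D) t {x}"
    proof (rule weak_netI_homog[OF assms(3)])
      fix c assume c: "c \<in> deep_coeffs \<mu> ?d t" "(\<lambda>x. evalf ?d c (homog x)) \<in> poly_space D"
      obtain c1 where c1: "\<And>x. evalf ?d c (homog x) = evalf (Suc 0) c1 (homog x)"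
        using poly_space_homog[OF c(2), of "Suc 0"] D by auto
      obtain e where e: "\<And>y. evalf (Suc 0) c1 y = (\<Sum>j\<in>UNIV. e j * y $ j)"
        using forms_1_linear[OF evalf_in_forms] by blast
      have "0 < (\<Sum>y\<in>F. w y * evalf ?d c y)" using F(4) GK c(1) by (simp add: G_def)
      also have "\<dots> = (\<Sum>y\<in>F. w y * (\<Sum>j\<in>UNIV. e j * y $ j))"
        using F(2) by (intro sum.cong) (auto simp: c1 e)
      also have "\<dots> = (\<Sum>j\<in>UNIV. e j * Y $ j)"
        unfolding Y_def sum_component sum_distrib_left
        by (subst sum.swap) (simp add: mult_ac)
      also have "\<dots> = W * (\<Sum>j\<in>UNIV. e j * homog x $ j)"
        unfolding Yx by (simp add: sum_distrib_left mult_ac)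
      finally show "\<exists>x\<in>{x}. evalf ?d c (homog x) \<ge> 0"
        using W by (simp add: c1 e zero_less_mult_iff)
    qed simp
    moreover have "m = 3" unfolding m_def cardE using True by simp
    ultimately show ?thesis using True by (intro exI[of _ "{x}"]) simp
  next
    case False
    have "\<exists>(F :: (real ^ 'n option) set) w y. finite F \<and> card F + CARD('n option) \<le> card ?E \<and>
      (\<forall>f\<in>F. w f \<ge> 0) \<and> (\<forall>c\<in>K. (\<Sum>f\<in>F. w f * evalf ?d c (y f)) > 0)"
    proof (rule few_points[OF assms(1) _ _ compK convK])
      show "CARD('n option) \<ge> 2" "\<not> (k = 1 \<and> CARD('n option) = 2)"
        using False by (simp_all add: card_UNIV_option)
      show "\<exists>y. evalf ?d c y > 0" if "c \<in> K" for c using posK[OF that] by blast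
      show "c \<in> K" if "c \<in> unit_coeffs ?d" "\<And>y. evalf ?d c y \<ge> 0" for c
        using GK[OF nonnegG[OF that]] .
    qed
    then obtain F :: "(real ^ 'n option) set" and w y
      where F: "finite F" "card F + CARD('n option) \<le> card ?E" "\<forall>f\<in>F. w f \<ge> 0"
        "\<forall>c\<in>K. (\<Sum>f\<in>F. w f * evalf ?d c (y f)) > 0" by blast
    have "(\<Sum>f\<in>F. w f * evalf ?d c (y f)) > 0" if "c \<in> G" for c using F(4) GK[OF that] by blast
    from move_off_infinity[OF compG F(1) this]
    obtain y' where y': "\<And>f. f \<in> F \<Longrightarrow> y' f $ None \<noteq> 0"
        "\<And>c. c \<in> G \<Longrightarrow> (\<Sum>f\<in>F. w f * evalf ?d c (y' f)) > 0" by blast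
    define pt where "pt f = (\<chi> j. y' f $ Some j / y' f $ None)" for f
    have "weak_net \<mu> (poly_plus D) t (pt ` F)"
    proof (rule weak_netI_homog[OF assms(3)])
      show "pt ` F \<noteq> {}" using G_ne y'(2) by fastforce
      fix c assume "c \<in> deep_coeffs \<mu> ?d t"
      hence "(\<Sum>f\<in>F. w f * evalf ?d c (y' f)) > 0" using y'(2) by (simp add: G_def)
      then obtain f where f: "f \<in> F" "w f * evalf ?d c (y' f) > 0"
        by (meson not_less sum_nonpos)
      hence "evalf ?d c (y' f) > 0" using F(3) by (auto simp: zero_less_mult_iff)
      \<comment> \<open>The exponent is even, so the sign survives even if the homogenising
        coordinate is negative.\<close>
      also have "evalf ?d c (y' f) = (y' f $ None) ^ ?d * evalf ?d c (homog (pt f))"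
        using dehomog[OF y'(1)[OF f(1)]] evalf_scaleR unfolding pt_def by metis
      finally have "evalf ?d c (homog (pt f)) > 0"
        by (simp add: zero_less_mult_iff)
      hence "evalf ?d c (homog (pt f)) \<ge> 0" by (rule less_imp_le)
      thus "\<exists>x\<in>pt ` F. evalf ?d c (homog x) \<ge> 0" using f(1) by (intro bexI[of _ "pt f"] imageI)
    qed
    moreover have "int (card (pt ` F)) \<le> int m - int CARD('n) - 1"
      using F(2) card_image_le[OF F(1), of pt] by (simp add: m_def card_UNIV_option)
    ultimately show ?thesis using F(1) by blast
  qed
  \<comment> \<open>\<open>t\<close> is at most the required level, and a net for a smaller level is
    one for a larger level.\<close>
  moreover have "weak_net \<mu> (poly_plus D) (1 - 1 / (real m + 1) + \<delta>) X"
    if "weak_net \<mu> (poly_plus D) t X" for X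
    using that by (auto simp: weak_net_def t_def)
  ultimately show ?thesis unfolding m_def cardE by (auto simp: add.commute)
qed

end
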